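(* Consider the resource pooling policy with $0<p<\lambda<1$ and a phase-type job size distribution $(\alpha,S)$ with mean $1$. Let $R=\lambda\left(\lambda I-(1-p)S-\lambda\mathbf 1\alpha\right)^{-1}$. When $\omega$ is set such that $\pi_0(m,\omega)=\frac{1-\lambda}{1-p}$, then $\pi_q(m,\omega)$ is independent of $\omega$ and given by $$\pi_q(m,\omega)=\frac{1-\lambda}{1-p}\,\alpha R^q ,\qquad q=1,\dots,m-1.$$ Further, compute $$\left(\pi_m(m,\omega),\pi_{m+1}(m,\omega)\right)=\left(-\lambda\,\pi_{m-1}(m,\omega),\,0\right)\begin{bmatrix}(1-p)S-\lambda I&\lambda I\\(1-p)s^*\alpha+\omega I&(1-p)S-\omega I\end{bmatrix}^{-1};$$ then $\omega$ is the unique value such that $$\pi_0(m,\omega)+\sum_{q=1}^{m+1}\pi_q(m,\omega)\mathbf 1=1 .$$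
   Context: Job sizes have a phase-type (PH) distribution $(\alpha,S)$: $\alpha$ is a probability row vector of length $n_s$, $S$ an invertible $n_s\times n_s$ subgenerator matrix, $s^*=-S\mathbf 1$ ($\mathbf 1$ the all-ones column), and the mean is $\alpha(-S)^{-1}\mathbf 1=1$. Resource pooling chain (queue at the cavity): for an integer $m\ge0$ and $\omega\ge0$, consider the continuous-time Markov chain on the states $0$ and $(q,j)$, $1\le q\le m+1$, $1\le j\le n_s$ ($q$ = queue length, $j$ = service phase), with transitions: $0\to(1,j)$ at rate $\lambda\alpha_j$; $(q,j)\to(q+1,j)$ at rate $\lambda$ for $1\le q\le m$; $(q,j)\to(q,j')$ at rate $(1-p)S_{jj'}$ for $j\ne j'$; $(q,j)\to(q-1,j')$ at rate $(1-p)s_j^*\alpha_{j'}$ for $2\le q\le m+1$; $(1,j)\to0$ at rate $(1-p)s^*_j$; and an additional transition at rate $\omega$ from queue length $m+1$ to queue length $m$, keeping the phase. Let $\pi_0(m,\omega)$ be the stationary probability of state $0$ and, for $q\ge1$, let $\pi_q(m,\omega)$ be the row vector whose $j$-th entry is the stationary probability of $(q,j)$. For $\omega=\infty$ the states with queue length $m+1$ are transient and $\pi_0(m,\infty)$ is the idle probability of the M/PH/1 queue with room for $m$ jobs (arrival rate $\lambda$, service speed $1-p$), with $\pi_0(0,\infty)=1$. The integer $m$ in the claim is the one belonging to $\lambda$, $p$ and $(\alpha,S)$: the largest $m$ such that $\pi_0(m,\infty)>\frac{1-\lambda}{1-p}$. *)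

theory Defs
  imports "HOL-Analysis.Analysis"
begin

text \<open>
  Phase types. The phases are the elements of a finite type, so that a row vector of length
  \<open>n\<^sub>s\<close> is an element of \<^typ>\<open>real^'n\<close> and multiplies a matrix from the left by \<open>v*\<close>. The
  all-ones vector is \<^term>\<open>1 :: real^'n\<close>. Note that \<open>A ^ k\<close> would be a componentwise
  power, hence \<open>mat_power\<close>.
\<close>

primrec mat_power :: "real^'n^'n \<Rightarrow> nat \<Rightarrow> real^'n^'n" where
  "mat_power A 0 = mat 1"
| "mat_power A (Suc k) = mat_power A k ** A"

definition col_row :: "real^'n \<Rightarrow> real^'n \<Rightarrow> real^'n^'n" where
  "col_row u v = (\<chi> i j. u $ i * v $ j)"

definition exit_rates :: "real^'n^'n \<Rightarrow> real^'n" where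
  "exit_rates S = - (S *v 1)"

text \<open>Nonpositivity of the diagonal follows from the two conditions.\<close>

definition subgenerator :: "real^'n^'n \<Rightarrow> bool" where
  "subgenerator S \<longleftrightarrow> (\<forall>i j. i \<noteq> j \<longrightarrow> 0 \<le> S $ i $ j) \<and> (\<forall>i. (\<Sum>j\<in>UNIV. S $ i $ j) \<le> 0)"

definition phase_type :: "real^'n \<Rightarrow> real^'n^'n \<Rightarrow> bool" where
  "phase_type \<alpha> S \<longleftrightarrow>
     (\<forall>j. 0 \<le> \<alpha> $ j) \<and> (\<Sum>j\<in>UNIV. \<alpha> $ j) = 1 \<and> subgenerator S \<and> invertible S"

definition ph_mean :: "real^'n \<Rightarrow> real^'n^'n \<Rightarrow> real" where
  "ph_mean \<alpha> S = (\<alpha> v* matrix_inv (- S)) \<bullet> 1"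


text \<open>
  A continuous-time Markov chain on a finite state space \<open>X\<close> is given by its rates between distinct
  states of \<open>X\<close>; values of \<open>rate\<close> on the diagonal or outside \<open>X\<close> are irrelevant.
  A distribution is stationary iff it satisfies global balance.
\<close>

definition is_stationary :: "'s set \<Rightarrow> ('s \<Rightarrow> 's \<Rightarrow> real) \<Rightarrow> ('s \<Rightarrow> real) \<Rightarrow> bool" where
  "is_stationary X rate \<pi> \<longleftrightarrow>
     (\<forall>x. 0 \<le> \<pi> x) \<and> (\<forall>x. x \<notin> X \<longrightarrow> \<pi> x = 0) \<and> (\<Sum>x\<in>X. \<pi> x) = 1 \<and>
     (\<forall>x\<in>X. (\<Sum>y\<in>X - {x}. \<pi> y * rate y x) = \<pi> x * (\<Sum>y\<in>X - {x}. rate x y))"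

definition stationary :: "'s set \<Rightarrow> ('s \<Rightarrow> 's \<Rightarrow> real) \<Rightarrow> 's \<Rightarrow> real" where
  "stationary X rate = (THE \<pi>. is_stationary X rate \<pi>)"

text \<open>\<open>Idle\<close> is state 0; \<open>Busy q j\<close> has queue length \<open>q\<close> and service phase \<open>j\<close>.\<close>

datatype 'j qstate = Idle | Busy nat 'j

definition queue_states :: "nat \<Rightarrow> 'j qstate set" where
  "queue_states K = insert Idle {Busy q j |q j. 1 \<le> q \<and> q \<le> K}"

text \<open>
  M/PH/1 queue with arrival rate \<open>lam\<close> and service speed \<open>1 - p\<close>. Restricting these rates to
  \<^term>\<open>queue_states K\<close> gives the queue with room for \<open>K\<close> jobs, as arrivals beyond
  \<open>K\<close> are then blocked.
\<close>

fun mph1_rate :: "real \<Rightarrow> real \<Rightarrow> real^'n \<Rightarrow> real^'n^'n \<Rightarrow> 'n qstate \<Rightarrow> 'n qstate \<Rightarrow> real" where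
  "mph1_rate lam p \<alpha> S Idle Idle = 0"
| "mph1_rate lam p \<alpha> S Idle (Busy q j) = (if q = 1 then lam * \<alpha> $ j else 0)"
| "mph1_rate lam p \<alpha> S (Busy q j) Idle = (if q = 1 then (1 - p) * exit_rates S $ j else 0)"
| "mph1_rate lam p \<alpha> S (Busy q j) (Busy q' j') =
     (if q' = q + 1 \<and> j' = j then lam else 0)
   + (if q' = q \<and> j' \<noteq> j then (1 - p) * S $ j $ j' else 0)
   + (if q = q' + 1 then (1 - p) * exit_rates S $ j * \<alpha> $ j' else 0)"

definition mph1_idle :: "real \<Rightarrow> real \<Rightarrow> real^'n \<Rightarrow> real^'n^'n \<Rightarrow> nat \<Rightarrow> real" where
  "mph1_idle lam p \<alpha> S K = stationary (queue_states K) (mph1_rate lam p \<alpha> S) Idle"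

text \<open>
  The resource pooling chain lives on \<^term>\<open>queue_states (m + 1)\<close>. The additional transition at rate
  \<open>\<omega>\<close> keeps the phase, except that for \<open>m = 0\<close> it leads to \<open>Idle\<close>, which has no phase.
\<close>

fun omega_rate :: "nat \<Rightarrow> real \<Rightarrow> 'n qstate \<Rightarrow> 'n qstate \<Rightarrow> real" where
  "omega_rate m \<omega> Idle y = 0"
| "omega_rate m \<omega> (Busy q j) Idle = (if q = m + 1 \<and> m = 0 then \<omega> else 0)"
| "omega_rate m \<omega> (Busy q j) (Busy q' j') = (if q = m + 1 \<and> q' = m \<and> j' = j then \<omega> else 0)"

definition pool_stat ::
    "real \<Rightarrow> real \<Rightarrow> real^'n \<Rightarrow> real^'n^'n \<Rightarrow> nat \<Rightarrow> real \<Rightarrow> 'n qstate \<Rightarrow> real" where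
  "pool_stat lam p \<alpha> S m \<omega> =
     stationary (queue_states (m + 1)) (\<lambda>x y. mph1_rate lam p \<alpha> S x y + omega_rate m \<omega> x y)"

definition pool_idle :: "real \<Rightarrow> real \<Rightarrow> real^'n \<Rightarrow> real^'n^'n \<Rightarrow> nat \<Rightarrow> real \<Rightarrow> real" where
  "pool_idle lam p \<alpha> S m \<omega> = pool_stat lam p \<alpha> S m \<omega> Idle"

text \<open>
  The vector \<open>\<pi>\<^sub>q(m,\<omega>)\<close>. At \<open>q = 0\<close>, where \<open>\<pi>\<^sub>0\<close> is a scalar, it is read as
  \<open>\<pi>\<^sub>0 \<alpha>\<close>; this is used only for \<open>\<pi>\<^sub>m\<^sub>-\<^sub>1\<close> when \<open>m = 1\<close>.
\<close>

definition pool_level :: "real \<Rightarrow> real \<Rightarrow> real^'n \<Rightarrow> real^'n^'n \<Rightarrow> nat \<Rightarrow> real \<Rightarrow> nat \<Rightarrow> real^'n" where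
  "pool_level lam p \<alpha> S m \<omega> q =
     (if q = 0 then pool_idle lam p \<alpha> S m \<omega> *\<^sub>R \<alpha>
      else (\<chi> j. pool_stat lam p \<alpha> S m \<omega> (Busy q j)))"


definition R_denom :: "real \<Rightarrow> real \<Rightarrow> real^'n \<Rightarrow> real^'n^'n \<Rightarrow> real^'n^'n" where
  "R_denom lam p \<alpha> S = lam *\<^sub>R mat 1 - (1 - p) *\<^sub>R S - lam *\<^sub>R col_row 1 \<alpha>"

definition R_mat :: "real \<Rightarrow> real \<Rightarrow> real^'n \<Rightarrow> real^'n^'n \<Rightarrow> real^'n^'n" where
  "R_mat lam p \<alpha> S = lam *\<^sub>R matrix_inv (R_denom lam p \<alpha> S)"

definition join_vec :: "real^'n \<Rightarrow> real^'n \<Rightarrow> real^('n + 'n)" where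
  "join_vec u v = (\<chi> k. case k of Inl i \<Rightarrow> u $ i | Inr i \<Rightarrow> v $ i)"

definition block_mat ::
    "real^'n^'n \<Rightarrow> real^'n^'n \<Rightarrow> real^'n^'n \<Rightarrow> real^'n^'n \<Rightarrow> real^('n + 'n)^('n + 'n)" where
  "block_mat A B C D = (\<chi> k. case k of Inl i \<Rightarrow> join_vec (A $ i) (B $ i)
                                     | Inr i \<Rightarrow> join_vec (C $ i) (D $ i))"

definition top_block ::
    "real \<Rightarrow> real \<Rightarrow> real^'n \<Rightarrow> real^'n^'n \<Rightarrow> real \<Rightarrow> real^('n + 'n)^('n + 'n)" where
  "top_block lam p \<alpha> S \<omega> =
     block_mat ((1 - p) *\<^sub>R S - lam *\<^sub>R mat 1)
               (lam *\<^sub>R mat 1)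
               ((1 - p) *\<^sub>R col_row (exit_rates S) \<alpha> + \<omega> *\<^sub>R mat 1)
               ((1 - p) *\<^sub>R S - \<omega> *\<^sub>R mat 1)"

text \<open>
  The total mass as it is computed from a candidate \<open>\<omega>\<close>: with the closed-form levels
  \<open>(1-\<lambda>)/(1-p) \<alpha> R\<^sup>q\<close> below \<open>m\<close> and the block formula for the two top levels, and not with the actual
  stationary distribution at \<open>\<omega>\<close> (which always has mass 1). For \<open>m = 0\<close> the only level is
  \<open>m + 1 = 1\<close>; the block system then degenerates to its last block row and column, fed by
  arrivals from the idle state.
\<close>

definition level_formula :: "real \<Rightarrow> real \<Rightarrow> real^'n \<Rightarrow> real^'n^'n \<Rightarrow> nat \<Rightarrow> real^'n" where
  "level_formula lam p \<alpha> S q = ((1 - lam) / (1 - p)) *\<^sub>R (\<alpha> v* mat_power (R_mat lam p \<alpha> S) q)"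

definition top_formula ::
    "real \<Rightarrow> real \<Rightarrow> real^'n \<Rightarrow> real^'n^'n \<Rightarrow> real^'n \<Rightarrow> real \<Rightarrow> real^('n + 'n)" where
  "top_formula lam p \<alpha> S v \<omega> = join_vec (- lam *\<^sub>R v) 0 v* matrix_inv (top_block lam p \<alpha> S \<omega>)"

definition level_one_formula ::
    "real \<Rightarrow> real \<Rightarrow> real^'n \<Rightarrow> real^'n^'n \<Rightarrow> real^'n \<Rightarrow> real \<Rightarrow> real^'n" where
  "level_one_formula lam p \<alpha> S v \<omega> =
     (- lam *\<^sub>R v) v* matrix_inv ((1 - p) *\<^sub>R S - \<omega> *\<^sub>R mat 1)"

definition computed_mass ::
    "real \<Rightarrow> real \<Rightarrow> real^'n \<Rightarrow> real^'n^'n \<Rightarrow> nat \<Rightarrow> real \<Rightarrow> real" where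
  "computed_mass lam p \<alpha> S m \<omega> =
     (1 - lam) / (1 - p)
     + (if m = 0 then level_one_formula lam p \<alpha> S (level_formula lam p \<alpha> S 0) \<omega> \<bullet> 1
        else (\<Sum>q=1..m-1. level_formula lam p \<alpha> S q \<bullet> 1)
             + top_formula lam p \<alpha> S (level_formula lam p \<alpha> S (m - 1)) \<omega> \<bullet> 1)"

end

theory Submission
  imports Defs
begin

text \<open>
  Cutting between consecutive levels turns the balance equations below level \<open>m\<close> into
  \<open>\<pi>\<^sub>q (\<lambda>I - (1-p)S - \<lambda>1\<alpha>) = \<lambda> \<pi>\<^sub>q\<^sub>-\<^sub>1\<close>, so the stationary measure with weight 1 at the idle state is
  explicit, and \<open>\<pi>\<^sub>0(m,\<omega>)\<close> is the inverse of its total mass. All matrices involved are, up to sign,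
  subgenerators without a closed set of phases that has no exit; the minimum principle makes them
  invertible with a nonnegative inverse.

  The total mass depends on \<open>\<omega>\<close> only through the two top levels. If \<open>y\<close> is the solution of the top
  system at \<open>\<omega>'\<close> and \<open>h\<close> the vector of mean times spent in the top levels at \<open>\<omega>\<close>, then comparing
  the two systems shows that the mass at \<open>\<omega>\<close> minus the mass at \<open>\<omega>'\<close> is \<open>\<omega>' - \<omega>\<close> times the inner
  product of the upper part of \<open>y\<close> with the difference of the two parts of \<open>h\<close>, which is positive.
  Hence the mass is continuous and strictly decreasing. It is the mass of the queue with room for
  \<open>m + 1\<close> jobs at \<open>\<omega> = 0\<close> and exceeds that of the queue with room for \<open>m\<close> jobs by \<open>O(1/\<omega>)\<close>, so by
  the choice of \<open>m\<close> it takes the required value exactly once.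
\<close>

section \<open>Inverse matrices and nonnegative vectors\<close>

lemma matrix_inv_mult:
  assumes "invertible (A :: real^'n^'n)"
  shows "A ** matrix_inv A = mat 1" "matrix_inv A ** A = mat 1"
  using someI_ex[OF assms[unfolded invertible_def]] by (simp_all add: matrix_inv_def)

lemma vec_mult_matrix_inv_iff:
  assumes "invertible (A :: real^'n^'n)"
  shows "y = b v* matrix_inv A \<longleftrightarrow> y v* A = b"
  by (metis assms matrix_inv_mult vector_matrix_mul_assoc vector_matrix_mul_rid)

lemma matrix_inv_mult_vec:
  assumes "invertible (A :: real^'n^'n)"
  shows "A *v (matrix_inv A *v b) = b"
  by (simp add: assms matrix_inv_mult matrix_vector_mul_assoc)

lemma invertible_uminus:
  assumes "invertible (A :: real^'n^'n)"
  shows "invertible (- A)"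
  using scalar_invertible[OF _ assms, of "-1"] by simp

lemma inner_nonneg_vec:
  fixes x y :: "real^'n"
  assumes "0 \<le> x" "0 \<le> y"
  shows "0 \<le> x \<bullet> y"
  using assms by (auto simp: less_eq_vec_def inner_vec_def intro!: sum_nonneg)

lemma inner_pos_vec:
  fixes x y :: "real^'n"
  assumes "0 \<le> x" "x \<noteq> 0" "\<And>i. 0 < y $ i"
  shows "0 < x \<bullet> y"
proof -
  obtain i where "x $ i \<noteq> 0" using assms(2) by (auto simp: vec_eq_iff)
  then have "0 < x $ i" using assms(1) by (simp add: less_eq_vec_def order_less_le)
  then show ?thesis
    using assms(1,3) unfolding inner_vec_def
    by (intro sum_pos2[of _ i]) (auto simp: less_eq_vec_def less_imp_le)
qed

lemma inner_mono_vec: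
  fixes x y z :: "real^'n"
  assumes "0 \<le> x" "y \<le> z"
  shows "x \<bullet> y \<le> x \<bullet> z"
  using assms by (auto simp: less_eq_vec_def inner_vec_def intro!: sum_mono mult_left_mono)

lemma inner_one_vec: "(x :: real^'n) \<bullet> 1 = (\<Sum>i\<in>UNIV. x $ i)"
  by (simp add: inner_vec_def)

section \<open>Transient subgenerators\<close>

lemma exit_rates_nth: "exit_rates B $ i = - (\<Sum>j\<in>UNIV. B $ i $ j)"
  by (simp add: exit_rates_def matrix_vector_mult_def)

definition trap :: "real^'n^'n \<Rightarrow> 'n set \<Rightarrow> bool" where
  "trap B T \<longleftrightarrow> (\<forall>i\<in>T. exit_rates B $ i = 0 \<and> (\<forall>j. j \<notin> T \<longrightarrow> B $ i $ j = 0))"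

text \<open>Without a nonempty trap, an exit can be reached from every phase. This combinatorial
  form carries over to matrices built from \<open>S\<close>, since their traps yield traps of
  \<open>S\<close>; invertibility and signs follow from it.\<close>

definition transient :: "real^'n^'n \<Rightarrow> bool" where
  "transient B \<longleftrightarrow> subgenerator B \<and> (\<forall>T. trap B T \<longrightarrow> T = {})"

lemma subgenerator_exit_rates: "subgenerator B \<Longrightarrow> 0 \<le> exit_rates B"
  by (simp add: subgenerator_def less_eq_vec_def exit_rates_nth)

text \<open>
  On a trap, \<open>B z = 1\<close> would contradict the maximum principle.
\<close>

lemma invertible_imp_transient:
  fixes B :: "real^'n^'n"
  assumes B: "subgenerator B" and inv: "invertible B"
  shows "transient B"
  unfolding transient_def
proof (intro conjI allI impI B)
  fix T assume T: "trap B T"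
  show "T = {}"
  proof (rule ccontr)
    assume "T \<noteq> {}"
    define z where "z = matrix_inv B *v 1"
    have z: "B *v z = 1" unfolding z_def by (rule matrix_inv_mult_vec[OF inv])
    have "Max ((\<lambda>i. z $ i) ` T) \<in> (\<lambda>i. z $ i) ` T"
      using \<open>T \<noteq> {}\<close> by (intro Max_in) auto
    then obtain i where i: "i \<in> T" "z $ i = Max ((\<lambda>i. z $ i) ` T)" by auto
    have max: "z $ j \<le> z $ i" if "j \<in> T" for j using that i by simp
    have "(B *v z) $ i = (\<Sum>j\<in>UNIV. B $ i $ j * (z $ j - z $ i)) - z $ i * exit_rates B $ i"
      by (simp add: matrix_vector_mult_def exit_rates_nth right_diff_distrib sum_subtractf
          sum_distrib_left sum_distrib_right mult.commute)
    also have "\<dots> = (\<Sum>j\<in>UNIV. B $ i $ j * (z $ j - z $ i))"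
      using T i by (simp add: trap_def)
    also have "\<dots> \<le> 0"
    proof (rule sum_nonpos)
      fix j show "B $ i $ j * (z $ j - z $ i) \<le> 0"
        using B T i(1) max[of j]
        by (cases "j \<in> T"; cases "j = i") (auto simp: trap_def subgenerator_def mult_nonneg_nonpos)
    qed
    finally show False by (simp add: z)
  qed
qed

text \<open>At a phase where \<open>x\<close> attains a negative minimum \<open>M\<close>, the entry
  of \<open>B *v x\<close> is the sum of the nonnegative terms
  \<open>B $ i $ j * (x $ j - M)\<close> and \<open>- M * exit_rates B $ i\<close>. As it is at most
  0, all terms vanish, so the minimizing phases form a trap.\<close>

lemma transient_min_principle:
  fixes B :: "real^'n^'n"
  assumes B: "transient B" and x: "B *v x \<le> 0"
  shows "0 \<le> x"
proof (rule ccontr)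
  assume "\<not> 0 \<le> x"
  define M where "M = Min (range (\<lambda>i. x $ i))"
  have M: "M \<le> x $ i" for i by (simp add: M_def)
  have "M < 0" using \<open>\<not> 0 \<le> x\<close> M by (force simp: less_eq_vec_def not_le intro: le_less_trans)
  define T where "T = {i. x $ i = M}"
  have "M \<in> range (\<lambda>i. x $ i)" unfolding M_def by (intro Min_in) auto
  then have "T \<noteq> {}" by (auto simp: T_def)
  have sub: "subgenerator B" using B by (simp add: transient_def)
  have "trap B T" unfolding trap_def
  proof (intro ballI conjI allI impI)
    fix i assume i: "i \<in> T"
    have nn: "0 \<le> B $ i $ j * (x $ j - M)" for j
      using sub i M by (cases "j = i") (auto simp: T_def subgenerator_def)
    have ex: "0 \<le> exit_rates B $ i" using subgenerator_exit_rates[OF sub] by (simp add: less_eq_vec_def)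
    have "(\<Sum>j\<in>UNIV. B $ i $ j * (x $ j - M)) - M * exit_rates B $ i = (B *v x) $ i"
      by (simp add: matrix_vector_mult_def exit_rates_nth right_diff_distrib sum_subtractf
          sum_distrib_left sum_distrib_right mult.commute)
    also have "\<dots> \<le> 0" using x by (simp add: less_eq_vec_def)
    finally have le: "(\<Sum>j\<in>UNIV. B $ i $ j * (x $ j - M)) \<le> M * exit_rates B $ i" by simp
    moreover have "M * exit_rates B $ i \<le> 0" using \<open>M < 0\<close> ex by (simp add: mult_nonpos_nonneg)
    moreover have ge: "0 \<le> (\<Sum>j\<in>UNIV. B $ i $ j * (x $ j - M))" using nn by (simp add: sum_nonneg)
    ultimately have "M * exit_rates B $ i = 0" and sum0: "(\<Sum>j\<in>UNIV. B $ i $ j * (x $ j - M)) = 0"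
      by linarith+
    then show "exit_rates B $ i = 0" using \<open>M < 0\<close> by simp
    fix j assume "j \<notin> T"
    have "B $ i $ j * (x $ j - M) = 0"
      using sum0 nn by (subst (asm) sum_nonneg_eq_0_iff) auto
    then show "B $ i $ j = 0" using \<open>j \<notin> T\<close> by (simp add: T_def)
  qed
  with B \<open>T \<noteq> {}\<close> show False by (simp add: transient_def)
qed

text \<open>The minimum principle for \<open>x\<close> and \<open>- x\<close> makes the kernel
  trivial.\<close>

lemma transient_invertible:
  fixes B :: "real^'n^'n"
  assumes B: "transient B"
  shows "invertible B"
  unfolding invertible_left_inverse matrix_left_invertible_ker
proof (intro allI impI)
  fix x assume x: "B *v x = 0"
  have "B *v (- x) = - (B *v x)" using matrix_vector_mult_scaleR[of B "-1" x] by simp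
  then have "0 \<le> x" "0 \<le> - x"
    using x transient_min_principle[OF B, of x] transient_min_principle[OF B, of "- x"] by simp_all
  then show "x = 0" by (auto simp: less_eq_vec_def vec_eq_iff intro: order.antisym)
qed

text \<open>Dual form of the minimum principle, which makes the columns of
  \<open>- matrix_inv B\<close> nonnegative; \<open>y\<close> is recovered by pairing
  \<open>y v* B\<close> with them.\<close>

lemma transient_row_nonneg:
  fixes B :: "real^'n^'n"
  assumes B: "transient B" and y: "y v* B \<le> 0"
  shows "0 \<le> y"
  unfolding less_eq_vec_def
proof
  fix i
  \<comment> \<open>The \<open>i\<close>-th column of \<open>- matrix_inv B\<close>.\<close>
  define x where "x = matrix_inv B *v (- axis i 1)"
  have Bx: "B *v x = - axis i 1" unfolding x_def by (rule matrix_inv_mult_vec[OF transient_invertible[OF B]])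
  have "0 \<le> x" by (rule transient_min_principle[OF B]) (simp add: Bx less_eq_vec_def axis_def)
  have "- (y $ i) = y \<bullet> (B *v x)" by (simp add: Bx inner_axis)
  also have "\<dots> = (y v* B) \<bullet> x" by (simp add: dot_lmul_matrix)
  also have "\<dots> \<le> 0" using inner_nonneg_vec[of "- (y v* B)" x] y \<open>0 \<le> x\<close>
    by (simp add: less_eq_vec_def)
  finally show "0 $ i \<le> y $ i" by simp
qed

text \<open>\<open>h\<close> holds the mean times to absorption. A zero entry would be a minimum and
  would make the corresponding entry of \<open>B *v h\<close> nonnegative instead of -1.\<close>

lemma transient_mean_time_pos:
  fixes B :: "real^'n^'n"
  assumes B: "transient B" and h: "B *v h = - 1"
  shows "0 < h $ i"
proof -
  have nn: "0 \<le> h" by (rule transient_min_principle[OF B]) (simp add: h less_eq_vec_def)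
  have "h $ i \<noteq> 0"
  proof
    assume "h $ i = 0"
    then have "0 \<le> B $ i $ j * h $ j" for j
      using nn B by (cases "j = i") (auto simp: transient_def subgenerator_def less_eq_vec_def)
    then have "0 \<le> (B *v h) $ i" by (simp add: matrix_vector_mult_def sum_nonneg)
    then show False by (simp add: h)
  qed
  then show ?thesis using nn by (simp add: less_eq_vec_def order_less_le)
qed

text \<open>Killing at rate \<kappa> only adds to the exit rates, and off the diagonal the entries
  are those of \<open>S\<close>, scaled; so every trap is already one of \<open>S\<close>. The case
  \<kappa> = 0 is included for the mean service times.\<close>

lemma transient_resolvent:
  fixes S :: "real^'n^'n"
  assumes S: "transient S" and "0 < \<mu>" "0 \<le> \<kappa>"
  shows "transient (\<mu> *\<^sub>R S - \<kappa> *\<^sub>R mat 1)"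
proof -
  have ex: "exit_rates (\<mu> *\<^sub>R S - \<kappa> *\<^sub>R mat 1) $ i = \<mu> * exit_rates S $ i + \<kappa>" for i
    by (simp add: exit_rates_nth mat_def sum_subtractf flip: sum_distrib_left)
  have s: "0 \<le> exit_rates S $ i" for i
    using S subgenerator_exit_rates[of S] by (simp add: transient_def less_eq_vec_def)
  have "subgenerator (\<mu> *\<^sub>R S - \<kappa> *\<^sub>R mat 1)"
    unfolding subgenerator_def
  proof (intro conjI allI impI)
    fix i j :: 'n assume "i \<noteq> j"
    then show "0 \<le> (\<mu> *\<^sub>R S - \<kappa> *\<^sub>R mat 1) $ i $ j"
      using S assms by (simp add: transient_def subgenerator_def mat_def)
  next
    fix i
    show "(\<Sum>j\<in>UNIV. (\<mu> *\<^sub>R S - \<kappa> *\<^sub>R mat 1) $ i $ j) \<le> 0"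
      using ex[of i] s[of i] assms unfolding exit_rates_nth[of "\<mu> *\<^sub>R S - _"]
      by (smt (verit) mult_nonneg_nonneg)
  qed
  moreover have "trap S T" if T: "trap (\<mu> *\<^sub>R S - \<kappa> *\<^sub>R mat 1) T" for T
    unfolding trap_def
  proof (intro ballI conjI allI impI)
    fix i assume i: "i \<in> T"
    then have "\<mu> * exit_rates S $ i + \<kappa> = 0" using T by (simp add: trap_def ex)
    then have "\<mu> * exit_rates S $ i = 0"
      using assms s[of i] by (smt (verit) mult_nonneg_nonneg)
    then show "exit_rates S $ i = 0" using assms by simp
    fix j assume "j \<notin> T"
    then show "S $ i $ j = 0" using i T assms by (auto simp: trap_def mat_def split: if_splits)
  qed
  ultimately show ?thesis using S by (simp add: transient_def)
qed

text \<open>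
  Up to scaling, \<open>x\<close> is the Laplace transform of the remaining service time, so it never vanishes.
\<close>

lemma transient_transform_pos:
  fixes S :: "real^'n^'n"
  assumes S: "transient S" and "0 < \<mu>" "0 \<le> \<kappa>" "0 < c"
    and x: "(\<mu> *\<^sub>R S - \<kappa> *\<^sub>R mat 1) *v x = - c *\<^sub>R exit_rates S"
  shows "0 < x $ i"
proof -
  have s: "0 \<le> exit_rates S $ i" for i
    using S subgenerator_exit_rates[of S] by (simp add: transient_def less_eq_vec_def)
  have nn: "0 \<le> x"
    by (rule transient_min_principle[OF transient_resolvent[OF assms(1-3)]])
       (use x s \<open>0 < c\<close> in \<open>simp add: less_eq_vec_def\<close>)
  \<comment> \<open>At a zero of \<open>x\<close> the equation equates a nonnegative sum with a
    nonpositive exit term. Both vanish, so there is neither an exit nor a jump out of the zero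
    set.\<close>
  have "trap S {i. x $ i = 0}" unfolding trap_def
  proof (intro ballI conjI allI impI)
    fix i assume i: "i \<in> {i. x $ i = 0}"
    have t: "0 \<le> S $ i $ j * x $ j" for j
      using i nn S by (cases "j = i") (auto simp: transient_def subgenerator_def less_eq_vec_def)
    have "((\<mu> *\<^sub>R S - \<kappa> *\<^sub>R mat 1) *v x) $ i = \<mu> * (\<Sum>j\<in>UNIV. S $ i $ j * x $ j)"
      using i by (simp add: matrix_vector_mult_diff_rdistrib flip: scaleR_matrix_vector_assoc)
        (simp add: matrix_vector_mult_def)
    then have "\<mu> * (\<Sum>j\<in>UNIV. S $ i $ j * x $ j) = - c * exit_rates S $ i" using x by simp
    moreover have "0 \<le> (\<Sum>j\<in>UNIV. S $ i $ j * x $ j)" using t by (simp add: sum_nonneg)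
    then have "0 \<le> \<mu> * (\<Sum>j\<in>UNIV. S $ i $ j * x $ j)" using \<open>0 < \<mu>\<close> by simp
    moreover have "0 \<le> c * exit_rates S $ i" using \<open>0 < c\<close> s by simp
    ultimately have "c * exit_rates S $ i = 0" and "\<mu> * (\<Sum>j\<in>UNIV. S $ i $ j * x $ j) = 0" by linarith+
    then show "exit_rates S $ i = 0" using \<open>0 < c\<close> by simp
    fix j assume j: "j \<notin> {i. x $ i = 0}"
    have "(\<Sum>j\<in>UNIV. S $ i $ j * x $ j) = 0" using \<open>\<mu> * _ = 0\<close> \<open>0 < \<mu>\<close> by simp
    then have "S $ i $ j * x $ j = 0" using t by (subst (asm) sum_nonneg_eq_0_iff) auto
    then show "S $ i $ j = 0" using j by simp
  qed
  then have "x $ i \<noteq> 0" using S by (auto simp: transient_def)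
  then show ?thesis using nn by (simp add: less_eq_vec_def order_less_le)
qed

section \<open>Block vectors and matrices\<close>

lemma sum_UNIV_sum: "(\<Sum>k\<in>(UNIV :: ('a::finite + 'b::finite) set). f k)
    = (\<Sum>i\<in>UNIV. f (Inl i)) + (\<Sum>i\<in>UNIV. f (Inr i))"
  by (simp flip: UNIV_Plus_UNIV add: sum.Plus)

lemma join_vec_nth [simp]: "join_vec u v $ Inl i = u $ i" "join_vec u v $ Inr i = v $ i"
  by (simp_all add: join_vec_def)

lemma block_mat_nth [simp]:
  "block_mat A B C D $ Inl i = join_vec (A $ i) (B $ i)"
  "block_mat A B C D $ Inr i = join_vec (C $ i) (D $ i)"
  by (simp_all add: block_mat_def)

lemma vec_sum_eq_iff: "(x :: real^('n::finite + 'n)) = y \<longleftrightarrow>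
    (\<forall>i. x $ Inl i = y $ Inl i) \<and> (\<forall>i. x $ Inr i = y $ Inr i)"
  by (metis (mono_tags, lifting) old.sum.exhaust vec_eq_iff)

lemma vec_sum_le_iff: "(x :: real^('n::finite + 'n)) \<le> y \<longleftrightarrow>
    (\<forall>i. x $ Inl i \<le> y $ Inl i) \<and> (\<forall>i. x $ Inr i \<le> y $ Inr i)"
  unfolding less_eq_vec_def by (metis old.sum.exhaust)

lemma join_vec_eq_iff [simp]: "join_vec u v = join_vec u' v' \<longleftrightarrow> u = u' \<and> v = v'"
  by (simp add: vec_sum_eq_iff) (simp add: vec_eq_iff)

lemma join_vec_surj: "\<exists>u v. x = join_vec u v"
  by (rule exI[of _ "\<chi> i. x $ Inl i"], rule exI[of _ "\<chi> i. x $ Inr i"]) (simp add: vec_sum_eq_iff)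

lemma join_vec_le_iff [simp]: "join_vec u v \<le> join_vec u' v' \<longleftrightarrow> u \<le> u' \<and> v \<le> v'"
  by (simp add: vec_sum_le_iff) (simp add: less_eq_vec_def)

lemma join_vec_0: "join_vec 0 0 = 0"
  and join_vec_1: "join_vec 1 1 = 1"
  and join_vec_minus: "- join_vec u v = join_vec (- u) (- v)"
  and join_vec_scaleR: "c *\<^sub>R join_vec u v = join_vec (c *\<^sub>R u) (c *\<^sub>R v)"
  by (simp_all add: vec_sum_eq_iff)

lemma join_vec_inner: "join_vec u v \<bullet> join_vec x y = u \<bullet> x + v \<bullet> y"
  by (simp add: inner_vec_def sum_UNIV_sum)

lemma join_vec_mult_block: "join_vec u v v* block_mat A B C D
    = join_vec (u v* A + v v* C) (u v* B + v v* D)"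
  by (simp add: vec_sum_eq_iff vector_matrix_mult_def sum_UNIV_sum)

lemma block_mult_join_vec: "block_mat A B C D *v join_vec x y
    = join_vec (A *v x + B *v y) (C *v x + D *v y)"
  by (simp add: vec_sum_eq_iff matrix_vector_mult_def sum_UNIV_sum)

lemma vec_mult_col_row: "x v* col_row u v = (x \<bullet> u) *\<^sub>R v"
  by (simp add: vec_eq_iff vector_matrix_mult_def col_row_def inner_vec_def sum_distrib_right mult.assoc)

lemma col_row_mult_vec: "col_row u v *v x = (v \<bullet> x) *\<^sub>R u"
  by (simp add: vec_eq_iff matrix_vector_mult_def col_row_def inner_vec_def sum_distrib_left
      mult.assoc mult.commute mult.left_commute)

lemma row_sum: "(\<Sum>j\<in>UNIV. B $ i $ j) = - exit_rates B $ i"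
  by (simp add: exit_rates_nth)

section \<open>Transience of the matrices of the queue\<close>

locale mph1_queue =
  fixes lam p :: real and \<alpha> :: "real^'n" and S :: "real^'n^'n"
  assumes lam_pos: "0 < lam" and p_less_1: "p < 1" and phase_type: "phase_type \<alpha> S"
begin

abbreviation "\<mu> \<equiv> 1 - p"
abbreviation "s \<equiv> exit_rates S"
abbreviation "A \<equiv> R_denom lam p \<alpha> S"
abbreviation "R \<equiv> R_mat lam p \<alpha> S"
abbreviation "Top \<equiv> top_block lam p \<alpha> S"

lemma mu_pos: "0 < \<mu>" using p_less_1 by simp

lemma alpha: "0 \<le> \<alpha>" "\<alpha> \<bullet> 1 = 1"
  using phase_type by (auto simp: phase_type_def less_eq_vec_def inner_one_vec)

lemma transient_S: "transient S"
  using phase_type by (simp add: phase_type_def invertible_imp_transient)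

lemma s_nonneg: "0 \<le> s"
  using transient_S by (simp add: transient_def subgenerator_exit_rates)

lemma S_mult_1: "S *v 1 = - s"
  by (simp add: exit_rates_def)

lemma inner_S_mult_1: "(x v* S) \<bullet> 1 = - (x \<bullet> s)"
  by (simp add: dot_lmul_matrix S_mult_1)

lemmas transient_S_minus = transient_resolvent[OF transient_S mu_pos]

text \<open>\<open>lam *\<^sub>R col_row 1 \<alpha> - lam *\<^sub>R mat 1\<close> redraws the phase
  from \<alpha> at rate \<open>lam\<close> and has row sums 0, so the only exits are service
  completions.\<close>

lemma exit_rates_minus_A: "exit_rates (- A) = \<mu> *\<^sub>R s"
proof -
  have "- A = \<mu> *\<^sub>R S + lam *\<^sub>R col_row 1 \<alpha> - lam *\<^sub>R mat 1" by (simp add: R_denom_def)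
  then have "(- A) *v 1 = - (\<mu> *\<^sub>R s)"
    by (simp add: matrix_vector_mult_diff_rdistrib matrix_vector_mult_add_rdistrib
        col_row_mult_vec S_mult_1 alpha flip: scaleR_matrix_vector_assoc)
  then show ?thesis unfolding exit_rates_def[of "- A"] by simp
qed

text \<open>Off the diagonal, an entry of \<open>- A\<close> is a sum of two nonnegative terms, so
  where it vanishes the entry of \<open>S\<close> vanishes too.\<close>

lemma transient_minus_A: "transient (- A)"
proof -
  have "subgenerator (- A)" unfolding subgenerator_def
  proof (intro conjI allI impI)
    fix i j :: 'n assume "i \<noteq> j"
    then show "0 \<le> (- A) $ i $ j"
      using transient_S mu_pos lam_pos alpha
      by (simp add: R_denom_def transient_def subgenerator_def mat_def col_row_def less_eq_vec_def)
  next
    fix i show "(\<Sum>j\<in>UNIV. (- A) $ i $ j) \<le> 0"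
      using s_nonneg mu_pos unfolding row_sum exit_rates_minus_A by (simp add: less_eq_vec_def)
  qed
  moreover have "trap S T" if T: "trap (- A) T" for T
    unfolding trap_def
  proof (intro ballI conjI allI impI)
    fix i assume i: "i \<in> T"
    then show "s $ i = 0" using T mu_pos by (simp add: trap_def exit_rates_minus_A)
    fix j assume j: "j \<notin> T"
    then have "\<mu> * S $ i $ j + lam * \<alpha> $ j = 0" "i \<noteq> j"
      using T i by (auto simp: trap_def R_denom_def mat_def col_row_def)
    moreover have "0 \<le> \<mu> * S $ i $ j" "0 \<le> lam * \<alpha> $ j"
      using transient_S mu_pos lam_pos alpha \<open>i \<noteq> j\<close>
      by (simp_all add: transient_def subgenerator_def less_eq_vec_def)
    ultimately have "\<mu> * S $ i $ j = 0" by linarith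
    then show "S $ i $ j = 0" using mu_pos by simp
  qed
  ultimately show ?thesis using transient_S by (simp add: transient_def)
qed

lemma invertible_A: "invertible A"
  using invertible_uminus[OF transient_invertible[OF transient_minus_A]] by simp

text \<open>The only way out of the two top levels is a service completion at the lower one. From
  the upper one, completions and \<omega>-transitions lead to the lower one, and arrivals do not
  occur.\<close>

lemma exit_rates_Top: "exit_rates (Top \<omega>) = join_vec (\<mu> *\<^sub>R s) 0"
proof -
  have "Top \<omega> *v join_vec 1 1 = - join_vec (\<mu> *\<^sub>R s) 0"
    by (simp add: top_block_def block_mult_join_vec matrix_vector_mult_diff_rdistrib
        matrix_vector_mult_add_rdistrib col_row_mult_vec S_mult_1 alpha join_vec_minus
        flip: scaleR_matrix_vector_assoc)
  then show ?thesis unfolding exit_rates_def[of "Top \<omega>"] by (simp add: join_vec_1)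
qed

text \<open>The lower phases of a trap form a trap of \<open>S\<close>, so there are none. Hence the
  upper ones cannot jump down, their completion rates are 0, and they form a trap of
  \<open>S\<close> as well.\<close>

lemma transient_Top:
  assumes "0 \<le> \<omega>"
  shows "transient (Top \<omega>)"
proof -
  have S0: "0 \<le> S $ i $ j" if "i \<noteq> j" for i j
    using that transient_S by (simp add: transient_def subgenerator_def)
  have s0: "0 \<le> s $ i" and a0: "0 \<le> \<alpha> $ i" for i
    using s_nonneg alpha by (simp_all add: less_eq_vec_def)
  have "subgenerator (Top \<omega>)" unfolding subgenerator_def
  proof (intro conjI allI impI)
    fix i j :: "'n + 'n" assume "i \<noteq> j"
    then show "0 \<le> Top \<omega> $ i $ j"
      using S0 s0 a0 mu_pos lam_pos assms
      by (cases i; cases j) (auto simp: top_block_def mat_def col_row_def)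
  next
    fix i show "(\<Sum>j\<in>UNIV. Top \<omega> $ i $ j) \<le> 0"
      using s0 mu_pos unfolding row_sum exit_rates_Top by (cases i) simp_all
  qed
  moreover have "T = {}" if T: "trap (Top \<omega>) T" for T
  proof -
    have TD: "exit_rates (Top \<omega>) $ k = 0" "l \<notin> T \<Longrightarrow> Top \<omega> $ k $ l = 0" if "k \<in> T" for k l
      using T that by (auto simp: trap_def)
    have "trap S {i. Inl i \<in> T}" unfolding trap_def
    proof (intro ballI conjI allI impI)
      fix i assume i: "i \<in> {i. Inl i \<in> T}"
      then show "s $ i = 0" using TD(1)[of "Inl i"] mu_pos by (simp add: exit_rates_Top)
      fix j assume "j \<notin> {i. Inl i \<in> T}"
      then show "S $ i $ j = 0"
        using TD(2)[of "Inl i" "Inl j"] i mu_pos by (auto simp: top_block_def mat_def split: if_splits)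
    qed
    then have l: "Inl i \<notin> T" for i using transient_S by (auto simp: transient_def)
    have "trap S {i. Inr i \<in> T}" unfolding trap_def
    proof (intro ballI conjI allI impI)
      fix i assume i: "i \<in> {i. Inr i \<in> T}"
      have z: "\<mu> * (s $ i * \<alpha> $ j) + (if i = j then \<omega> else 0) = 0" for j
        using TD(2)[of "Inr i" "Inl j"] i l by (simp add: top_block_def mat_def col_row_def if_distrib cong: if_cong)
      have "s $ i * \<alpha> $ j = 0" for j
        using z[of j] mu_pos assms mult_nonneg_nonneg[OF s0 a0, of i j]
        by (smt (verit) mult_pos_pos)
      \<comment> \<open>As \<alpha> has total mass 1, summing over \<open>j\<close> isolates
        \<open>s $ i\<close>.\<close>
      then have "(\<Sum>j\<in>UNIV. s $ i * \<alpha> $ j) = 0" by (intro sum.neutral ballI)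
      then show "s $ i = 0" using alpha by (simp add: inner_one_vec flip: sum_distrib_left)
      fix j assume "j \<notin> {i. Inr i \<in> T}"
      then show "S $ i $ j = 0"
        using TD(2)[of "Inr i" "Inr j"] i mu_pos by (auto simp: top_block_def mat_def split: if_splits)
    qed
    then have r: "Inr i \<notin> T" for i using transient_S by (auto simp: transient_def)
    show "T = {}" using l r by (metis all_not_in_conv old.sum.exhaust)
  qed
  ultimately show ?thesis by (simp add: transient_def)
qed

end

section \<open>Balance equations by level\<close>

lemma queue_states_eq: "queue_states K = insert Idle ((\<lambda>(q, j). Busy q j) ` ({1..K} \<times> UNIV))"
  by (auto simp: queue_states_def)

lemma finite_queue_states: "finite (queue_states K :: 'j::finite qstate set)"
  by (simp add: queue_states_eq)

lemma sum_queue_states: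
  fixes f :: "'j::finite qstate \<Rightarrow> real"
  shows "(\<Sum>x\<in>queue_states K. f x) = f Idle + (\<Sum>q=1..K. \<Sum>j\<in>UNIV. f (Busy q j))"
proof -
  have "inj_on (\<lambda>(q, j :: 'j). Busy q j) ({1..K} \<times> UNIV)" by (auto simp: inj_on_def)
  then have "(\<Sum>x\<in>(\<lambda>(q, j). Busy q j) ` ({1..K} \<times> UNIV). f x)
      = (\<Sum>(q, j)\<in>{1..K} \<times> UNIV. f (Busy q j))"
    by (simp add: sum.reindex case_prod_unfold)
  moreover have "Idle \<notin> (\<lambda>(q, j :: 'j). Busy q j) ` ({1..K} \<times> UNIV)" by auto
  ultimately show ?thesis by (simp add: queue_states_eq sum.cartesian_product)
qed

text \<open>Inflow and outflow are split into sums over one state or one level each; the range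
  condition on \<open>a\<close> removes transitions from or to levels that do not exist.\<close>

lemma sum_single_state:
  fixes a K :: nat
  shows "(\<Sum>q=1..K. \<Sum>j\<in>UNIV. if q = a \<and> j = b then f q j else 0)
    = (if 1 \<le> a \<and> a \<le> K then f a (b :: 'j::finite) else (0 :: real))"
proof -
  have "(\<Sum>j\<in>UNIV. if q = a \<and> j = b then f q j else 0) = (if q = a then f a b else 0)" for q
    by (cases "q = a") simp_all
  then show ?thesis by simp
qed

lemma sum_single_level:
  fixes a K :: nat
  shows "(\<Sum>q=1..K. \<Sum>j\<in>UNIV. if q = a then f q j else 0)
    = (if 1 \<le> a \<and> a \<le> K then (\<Sum>j\<in>UNIV. f a (j :: 'j::finite)) else (0 :: real))"
proof -
  have "(\<Sum>j\<in>UNIV. if q = a then f q j else 0) = (if q = a then (\<Sum>j\<in>UNIV. f a j) else 0)" for q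
    by (cases "q = a") simp_all
  then show ?thesis by simp
qed

definition (in mph1_queue) rate :: "nat \<Rightarrow> real \<Rightarrow> 'n qstate \<Rightarrow> 'n qstate \<Rightarrow> real" where
  "rate m \<omega> x y = mph1_rate lam p \<alpha> S x y + omega_rate m \<omega> x y"

definition (in mph1_queue) level :: "('n qstate \<Rightarrow> real) \<Rightarrow> nat \<Rightarrow> real^'n" where
  "level \<pi> q = (if q = 0 then \<pi> Idle *\<^sub>R \<alpha> else (\<chi> j. \<pi> (Busy q j)))"

text \<open>Global balance after cancelling the diagonal of \<open>S\<close>: for the idle state,
  the levels between 0 and \<open>m\<close>, level \<open>m\<close> and level \<open>m + 1\<close>.
  With \<open>L 0\<close> read as \<open>x *\<^sub>R \<alpha>\<close>, arrivals from the idle state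
  have the same form as those from a busy level.\<close>

definition (in mph1_queue) balanced :: "nat \<Rightarrow> real \<Rightarrow> real \<Rightarrow> (nat \<Rightarrow> real^'n) \<Rightarrow> bool" where
  "balanced m \<omega> x L \<longleftrightarrow>
     \<mu> * (L 1 \<bullet> s) + (if m = 0 then \<omega> * (L 1 \<bullet> 1) else 0) = lam * x
   \<and> (\<forall>q. 1 \<le> q \<and> q < m \<longrightarrow>
        lam *\<^sub>R L (q - 1) + \<mu> *\<^sub>R (L q v* S) + (\<mu> * (L (q + 1) \<bullet> s)) *\<^sub>R \<alpha> = lam *\<^sub>R L q)
   \<and> (1 \<le> m \<longrightarrow> lam *\<^sub>R L (m - 1) + \<mu> *\<^sub>R (L m v* S) + (\<mu> * (L (m + 1) \<bullet> s)) *\<^sub>R \<alpha>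
        + \<omega> *\<^sub>R L (m + 1) = lam *\<^sub>R L m)
   \<and> lam *\<^sub>R L m + \<mu> *\<^sub>R (L (m + 1) v* S) = \<omega> *\<^sub>R L (m + 1)"

context mph1_queue
begin

lemma rate_self [simp]: "rate m \<omega> x x = 0"
  by (cases x) (simp_all add: rate_def)

lemma sum_alpha: "(\<Sum>j\<in>UNIV. \<alpha> $ j) = 1"
  using alpha(2) by (simp add: inner_one_vec)

lemma sum_other_states:
  assumes "f x = 0"
  shows "(\<Sum>y\<in>queue_states K - {x}. f y) = (\<Sum>y\<in>queue_states K. f (y :: 'n qstate) :: real)"
  by (rule sum.mono_neutral_left) (use assms finite_queue_states in auto)

lemma inflow_Idle:
  "(\<Sum>y\<in>queue_states (m + 1). \<pi> y * rate m \<omega> y Idle)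
    = \<mu> * (level \<pi> 1 \<bullet> s) + (if m = 0 then \<omega> * (level \<pi> 1 \<bullet> 1) else 0)"
proof -
  have "(\<Sum>y\<in>queue_states (m + 1). \<pi> y * rate m \<omega> y Idle)
    = (\<Sum>q=1..m+1. \<Sum>j\<in>UNIV. if q = 1 then \<pi> (Busy 1 j) * (\<mu> * s $ j + (if m = 0 then \<omega> else 0)) else 0)"
    unfolding sum_queue_states by (auto simp: rate_def intro!: sum.cong)
  also have "\<dots> = (\<Sum>j\<in>UNIV. \<pi> (Busy 1 j) * (\<mu> * s $ j + (if m = 0 then \<omega> else 0)))"
    by (subst sum_single_level) simp
  also have "\<dots> = \<mu> * (level \<pi> 1 \<bullet> s) + (if m = 0 then \<omega> * (level \<pi> 1 \<bullet> 1) else 0)"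
    by (simp add: level_def inner_vec_def sum.distrib sum_distrib_left distrib_left
        mult.commute mult.left_commute)
  finally show ?thesis .
qed

lemma outflow_Idle: "(\<Sum>y\<in>queue_states (m + 1). rate m \<omega> Idle y) = lam"
proof -
  have "(\<Sum>y\<in>queue_states (m + 1). rate m \<omega> Idle y)
      = (\<Sum>q=1..m+1. \<Sum>j\<in>UNIV. if q = 1 then lam * \<alpha> $ j else 0)"
    unfolding sum_queue_states by (auto simp: rate_def intro!: sum.cong)
  also have "\<dots> = (\<Sum>j\<in>UNIV. lam * \<alpha> $ j)" by (subst sum_single_level) simp
  also have "\<dots> = lam" by (simp add: sum_alpha flip: sum_distrib_left)
  finally show ?thesis .
qed

text \<open>\<open>v* S\<close> also contains the diagonal, which is no transition. The term
  subtracted for it reappears in the outflow and cancels in the balance equation.\<close>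

lemma inflow_Busy:
  assumes q: "1 \<le> q" "q \<le> m + 1"
  shows "(\<Sum>y\<in>queue_states (m + 1). \<pi> y * rate m \<omega> y (Busy q j))
    = lam * level \<pi> (q - 1) $ j + \<mu> * (level \<pi> q v* S) $ j - \<mu> * S $ j $ j * level \<pi> q $ j
      + (if q \<le> m then \<mu> * (level \<pi> (q + 1) \<bullet> s) * \<alpha> $ j else 0)
      + (if q = m then \<omega> * level \<pi> (m + 1) $ j else 0)"
proof -
  \<comment> \<open>For \<open>q = 1\<close> the index \<open>q - 1\<close> lies outside the
    summation range; arrivals from the idle state are the separate first term.\<close>
  have "(\<Sum>y\<in>queue_states (m + 1). \<pi> y * rate m \<omega> y (Busy q j))
    = \<pi> Idle * (if q = 1 then lam * \<alpha> $ j else 0)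
     + ((\<Sum>q'=1..m+1. \<Sum>j'\<in>UNIV. if q' = q - 1 \<and> j' = j then lam * \<pi> (Busy q' j') else 0)
      + (\<Sum>q'=1..m+1. \<Sum>j'\<in>UNIV. if q' = q then \<pi> (Busy q' j') * (\<mu> * S $ j' $ j) else 0)
      + (\<Sum>q'=1..m+1. \<Sum>j'\<in>UNIV. if q' = q \<and> j' = j then - (\<pi> (Busy q' j') * (\<mu> * S $ j' $ j)) else 0)
      + (\<Sum>q'=1..m+1. \<Sum>j'\<in>UNIV. if q' = q + 1 then \<pi> (Busy q' j') * (\<mu> * s $ j' * \<alpha> $ j) else 0)
      + (\<Sum>q'=1..m+1. \<Sum>j'\<in>UNIV. if q' = m + 1 \<and> j' = j then (if q = m then \<omega> * \<pi> (Busy q' j') else 0) else 0))"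
    unfolding sum_queue_states sum.distrib[symmetric] using q
    by (intro arg_cong2[of _ _ _ _ "(+)"] sum.cong) (auto simp: rate_def algebra_simps)
  also have "\<dots> = \<pi> Idle * (if q = 1 then lam * \<alpha> $ j else 0)
     + ((if 2 \<le> q then lam * \<pi> (Busy (q - 1) j) else 0)
      + (\<Sum>j'\<in>UNIV. \<pi> (Busy q j') * (\<mu> * S $ j' $ j))
      + - (\<pi> (Busy q j) * (\<mu> * S $ j $ j))
      + (if q \<le> m then (\<Sum>j'\<in>UNIV. \<pi> (Busy (q + 1) j') * (\<mu> * s $ j' * \<alpha> $ j)) else 0)
      + (if q = m then \<omega> * \<pi> (Busy (m + 1) j) else 0))"
    unfolding sum_single_state sum_single_level using q by auto
  also have "\<dots> = lam * level \<pi> (q - 1) $ j + \<mu> * (level \<pi> q v* S) $ j - \<mu> * S $ j $ j * level \<pi> q $ j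
      + (if q \<le> m then \<mu> * (level \<pi> (q + 1) \<bullet> s) * \<alpha> $ j else 0)
      + (if q = m then \<omega> * level \<pi> (m + 1) $ j else 0)"
    using q by (auto simp: level_def inner_vec_def vector_matrix_mult_def sum_distrib_left
      sum_distrib_right mult_ac)
  finally show ?thesis .
qed

text \<open>Row \<open>j\<close> of \<open>S\<close> sums to \<open>- s $ j\<close>, so phase
  changes and completions together have rate \<open>- \<mu> * S $ j $ j\<close>, whether a
  completion leads to the level below or to the idle state.\<close>

lemma outflow_Busy:
  assumes q: "1 \<le> q" "q \<le> m + 1"
  shows "(\<Sum>y\<in>queue_states (m + 1). rate m \<omega> (Busy q j) y)
    = (if q \<le> m then lam else 0) - \<mu> * S $ j $ j + (if q = m + 1 then \<omega> else 0)"
proof -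
  have "(\<Sum>y\<in>queue_states (m + 1). rate m \<omega> (Busy q j) y)
    = (if q = 1 then \<mu> * s $ j + (if m = 0 then \<omega> else 0) else 0)
     + ((\<Sum>q'=1..m+1. \<Sum>j'\<in>UNIV. if q' = q + 1 \<and> j' = j then lam else 0)
      + (\<Sum>q'=1..m+1. \<Sum>j'\<in>UNIV. if q' = q then \<mu> * S $ j $ j' else 0)
      + (\<Sum>q'=1..m+1. \<Sum>j'\<in>UNIV. if q' = q \<and> j' = j then - (\<mu> * S $ j $ j') else 0)
      + (\<Sum>q'=1..m+1. \<Sum>j'\<in>UNIV. if q' = q - 1 then \<mu> * s $ j * \<alpha> $ j' else 0)
      + (\<Sum>q'=1..m+1. \<Sum>j'\<in>UNIV. if q' = m \<and> j' = j then (if q = m + 1 then \<omega> else 0) else 0))"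
    unfolding sum_queue_states sum.distrib[symmetric] using q
    by (intro arg_cong2[of _ _ _ _ "(+)"] sum.cong) (auto simp: rate_def algebra_simps)
  also have "\<dots> = (if q = 1 then \<mu> * s $ j + (if m = 0 then \<omega> else 0) else 0)
     + ((if q \<le> m then lam else 0)
      + (\<Sum>j'\<in>UNIV. \<mu> * S $ j $ j') + - (\<mu> * S $ j $ j)
      + (if 2 \<le> q then (\<Sum>j'\<in>UNIV. \<mu> * s $ j * \<alpha> $ j') else 0)
      + (if q = m + 1 \<and> 1 \<le> m then \<omega> else 0))"
    unfolding sum_single_state sum_single_level using q by auto
  also have "\<dots> = (if q \<le> m then lam else 0) - \<mu> * S $ j $ j + (if q = m + 1 then \<omega> else 0)"
    using q by (auto simp: sum_alpha row_sum simp flip: sum_distrib_left)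
  finally show ?thesis .
qed

lemma ball_levels:
  fixes m :: nat
  shows "(\<forall>q\<in>{1..m+1}. P q) \<longleftrightarrow> (\<forall>q. 1 \<le> q \<and> q < m \<longrightarrow> P q) \<and> (1 \<le> m \<longrightarrow> P m) \<and> P (m + 1)"
    (is "?L \<longleftrightarrow> ?R")
proof
  assume ?R
  show ?L
  proof
    fix q assume "q \<in> {1..m+1}"
    then have "(1 \<le> q \<and> q < m) \<or> (1 \<le> m \<and> q = m) \<or> q = m + 1" by auto
    then show "P q" using \<open>?R\<close> by auto
  qed
qed auto

lemma balanced_iff:
  "(\<forall>x\<in>queue_states (m + 1).
      (\<Sum>y\<in>queue_states (m + 1) - {x}. \<pi> y * rate m \<omega> y x)
      = \<pi> x * (\<Sum>y\<in>queue_states (m + 1) - {x}. rate m \<omega> x y))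
    \<longleftrightarrow> balanced m \<omega> (\<pi> Idle) (level \<pi>)" (is "?L \<longleftrightarrow> _")
proof -
  let ?E = "\<lambda>q. lam *\<^sub>R level \<pi> (q - 1) + \<mu> *\<^sub>R (level \<pi> q v* S)
      + (if q \<le> m then (\<mu> * (level \<pi> (q + 1) \<bullet> s)) *\<^sub>R \<alpha> else 0)
      + (if q = m then \<omega> *\<^sub>R level \<pi> (m + 1) else 0)
      = (if q \<le> m then lam *\<^sub>R level \<pi> q else 0) + (if q = m + 1 then \<omega> *\<^sub>R level \<pi> q else 0)"
  let ?B = "\<lambda>x. (\<Sum>y\<in>queue_states (m + 1). \<pi> y * rate m \<omega> y x)
      = \<pi> x * (\<Sum>y\<in>queue_states (m + 1). rate m \<omega> x y)"
  have lev: "(\<forall>j. ?B (Busy q j)) \<longleftrightarrow> ?E q" if "q \<in> {1..m+1}" for q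
  proof -
    have "?B (Busy q j) \<longleftrightarrow> lam * level \<pi> (q - 1) $ j + \<mu> * (level \<pi> q v* S) $ j
      + (if q \<le> m then (\<mu> * (level \<pi> (q + 1) \<bullet> s)) * \<alpha> $ j else 0)
      + (if q = m then \<omega> * level \<pi> (m + 1) $ j else 0)
      = (if q \<le> m then lam * level \<pi> q $ j else 0) + (if q = m + 1 then \<omega> * level \<pi> q $ j else 0)" for j
    proof -
      have "\<pi> (Busy q j) = level \<pi> q $ j" using that by (simp add: level_def)
      then show ?thesis using that
        by (subst inflow_Busy, simp, simp, subst outflow_Busy) (auto simp: algebra_simps)
    qed
    then show ?thesis by (simp add: vec_eq_iff if_distrib[of "\<lambda>v. v $ _"] cong: if_cong)
  qed
  have "?L \<longleftrightarrow> (\<forall>x\<in>queue_states (m + 1). ?B x)"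
    by (simp add: sum_other_states)
  also have "\<dots> \<longleftrightarrow> ?B Idle \<and> (\<forall>q\<in>{1..m+1}. \<forall>j. ?B (Busy q j))"
    by (auto simp: queue_states_def)
  also have "(\<forall>q\<in>{1..m+1}. \<forall>j. ?B (Busy q j)) \<longleftrightarrow> (\<forall>q\<in>{1..m+1}. ?E q)"
    by (rule ball_cong[OF refl lev])
  also have "\<dots> \<longleftrightarrow> (\<forall>q. 1 \<le> q \<and> q < m \<longrightarrow> ?E q) \<and> (1 \<le> m \<longrightarrow> ?E m) \<and> ?E (m + 1)"
    by (rule ball_levels)
  finally show ?thesis unfolding inflow_Idle outflow_Idle balanced_def by (simp add: mult.commute)
qed

lemma is_stationary_iff:
  "is_stationary (queue_states (m + 1)) (rate m \<omega>) \<pi> \<longleftrightarrow>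
     (\<forall>x. 0 \<le> \<pi> x) \<and> (\<forall>x. x \<notin> queue_states (m + 1) \<longrightarrow> \<pi> x = 0)
     \<and> \<pi> Idle + (\<Sum>q=1..m+1. level \<pi> q \<bullet> 1) = 1 \<and> balanced m \<omega> (\<pi> Idle) (level \<pi>)"
proof -
  have "(\<Sum>x\<in>queue_states (m + 1). \<pi> x) = \<pi> Idle + (\<Sum>q=1..m+1. level \<pi> q \<bullet> 1)"
    unfolding sum_queue_states by (simp add: level_def inner_one_vec)
  then show ?thesis by (simp only: is_stationary_def balanced_iff)
qed

end

section \<open>The stationary distribution\<close>

text \<open>The levels of an invariant measure of the queue with unlimited room, with weight 1 at
  the idle state.\<close>

definition (in mph1_queue) base :: "nat \<Rightarrow> real^'n" where
  "base q = \<alpha> v* mat_power R q"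

text \<open>
  The stationary measure that gives \<^const>\<open>Idle\<close> the weight 1. As in \<^const>\<open>pool_level\<close>, the entry
  at \<open>q = 0\<close> is \<open>\<alpha>\<close>.
\<close>

definition (in mph1_queue) unnorm :: "nat \<Rightarrow> real \<Rightarrow> nat \<Rightarrow> real^'n" where
  "unnorm m \<omega> q =
     (if q < m \<or> q = 0 then base q
      else if m = 0 then level_one_formula lam p \<alpha> S \<alpha> \<omega>
      else if q = m then (\<chi> i. top_formula lam p \<alpha> S (base (m - 1)) \<omega> $ Inl i)
      else (\<chi> i. top_formula lam p \<alpha> S (base (m - 1)) \<omega> $ Inr i))"

definition (in mph1_queue) mass :: "nat \<Rightarrow> real \<Rightarrow> real" where
  "mass m \<omega> = 1 + (\<Sum>q=1..m+1. unnorm m \<omega> q \<bullet> 1)"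

context mph1_queue
begin

lemma vec_mult_A: "x v* A = lam *\<^sub>R x - \<mu> *\<^sub>R (x v* S) - (lam * (x \<bullet> 1)) *\<^sub>R \<alpha>"
  by (simp add: R_denom_def vector_matrix_mult_diff_rdistrib vector_scaleR_matrix_ac vec_mult_col_row)

lemma vec_mult_R: "y = x v* R \<longleftrightarrow> y v* A = lam *\<^sub>R x"
proof -
  have "x v* R = (lam *\<^sub>R x) v* matrix_inv A"
    by (simp add: R_mat_def vector_scaleR_matrix_ac scaleR_vector_matrix_assoc)
  then show ?thesis using vec_mult_matrix_inv_iff[OF invertible_A] by metis
qed

lemma base_0 [simp]: "base 0 = \<alpha>"
  by (simp add: base_def)

lemma base_Suc: "base (Suc q) = base q v* R"
  by (simp add: base_def vector_matrix_mul_assoc)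

lemma base_Suc_mult_A: "base (Suc q) v* A = lam *\<^sub>R base q"
  using base_Suc vec_mult_R by blast

lemma base_nonneg: "0 \<le> base q"
proof (induction q)
  case (Suc q)
  have "base (Suc q) v* (- A) = - (base (Suc q) v* A)"
    using vector_scaleR_matrix_ac[of "base (Suc q)" "-1" A] by simp
  also have "\<dots> = - (lam *\<^sub>R base q)" by (simp add: base_Suc_mult_A)
  finally have "base (Suc q) v* (- A) \<le> 0" using Suc lam_pos by (simp add: less_eq_vec_def)
  then show ?case by (rule transient_row_nonneg[OF transient_minus_A])
qed (simp add: alpha)

lemma base_nonzero: "base q \<noteq> 0"
proof (induction q)
  case 0
  then show ?case using alpha(2) by auto
next
  case (Suc q)
  then show ?case using base_Suc_mult_A[of q] lam_pos by auto
qed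

text \<open>\<open>A *v 1 = \<mu> *\<^sub>R s\<close>, so summing over the phases balances
  completions at one level against arrivals at the level below.\<close>

lemma flow_cut:
  assumes "x v* A = lam *\<^sub>R w"
  shows "\<mu> * (x \<bullet> s) = lam * (w \<bullet> 1)"
  using arg_cong[OF assms, of "\<lambda>v. v \<bullet> 1"]
  by (simp add: vec_mult_A inner_diff_left inner_S_mult_1 alpha)

text \<open>For \<open>w = \<alpha>\<close> this is the balance of level 1 when \<open>m = 0\<close>
  and the idle state has weight 1. At \<omega> = 0 it describes the full level of a finite queue,
  fed by the level \<open>w\<close> below it.\<close>

lemma level_one_formula_iff:
  assumes "0 \<le> \<omega>"
  shows "v = level_one_formula lam p \<alpha> S w \<omega> \<longleftrightarrow> lam *\<^sub>R w + \<mu> *\<^sub>R (v v* S) = \<omega> *\<^sub>R v"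
proof -
  have "v = level_one_formula lam p \<alpha> S w \<omega> \<longleftrightarrow> v v* (\<mu> *\<^sub>R S - \<omega> *\<^sub>R mat 1) = - lam *\<^sub>R w"
    unfolding level_one_formula_def
    by (rule vec_mult_matrix_inv_iff[OF transient_invertible[OF transient_S_minus[OF assms]]])
  then show ?thesis
    by (auto simp: vector_matrix_mult_diff_rdistrib vector_scaleR_matrix_ac algebra_simps
        eq_neg_iff_add_eq_0)
qed

text \<open>Read by column blocks, the block system is the balance of levels \<open>m\<close> and
  \<open>m + 1\<close>, with \<open>w\<close> as level \<open>m - 1\<close>.\<close>

lemma top_formula_iff:
  assumes "0 \<le> \<omega>"
  shows "join_vec u v = top_formula lam p \<alpha> S w \<omega> \<longleftrightarrow>
    lam *\<^sub>R w + \<mu> *\<^sub>R (u v* S) + (\<mu> * (v \<bullet> s)) *\<^sub>R \<alpha> + \<omega> *\<^sub>R v = lam *\<^sub>R u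
    \<and> lam *\<^sub>R u + \<mu> *\<^sub>R (v v* S) = \<omega> *\<^sub>R v"
proof -
  have "join_vec u v = top_formula lam p \<alpha> S w \<omega> \<longleftrightarrow> join_vec u v v* Top \<omega> = join_vec (- lam *\<^sub>R w) 0"
    unfolding top_formula_def
    by (rule vec_mult_matrix_inv_iff[OF transient_invertible[OF transient_Top[OF assms]]])
  also have "\<dots> \<longleftrightarrow> \<mu> *\<^sub>R (u v* S) - lam *\<^sub>R u + ((\<mu> * (v \<bullet> s)) *\<^sub>R \<alpha> + \<omega> *\<^sub>R v) = - (lam *\<^sub>R w)
    \<and> lam *\<^sub>R u + (\<mu> *\<^sub>R (v v* S) - \<omega> *\<^sub>R v) = 0"
    by (simp add: top_block_def join_vec_mult_block vector_matrix_mult_diff_rdistrib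
        vector_matrix_mult_add_rdistrib vector_scaleR_matrix_ac vec_mult_col_row)
  also have "\<dots> \<longleftrightarrow> lam *\<^sub>R w + \<mu> *\<^sub>R (u v* S) + (\<mu> * (v \<bullet> s)) *\<^sub>R \<alpha> + \<omega> *\<^sub>R v = lam *\<^sub>R u
    \<and> lam *\<^sub>R u + \<mu> *\<^sub>R (v v* S) = \<omega> *\<^sub>R v"
    by (intro arg_cong2[of _ _ _ _ "(\<and>)"]) (simp_all add: vec_eq_iff algebra_simps)
  finally show ?thesis .
qed

lemma level_one_formula_nonneg:
  assumes "0 \<le> \<omega>" "0 \<le> w"
  shows "0 \<le> level_one_formula lam p \<alpha> S w \<omega>"
proof (rule transient_row_nonneg[OF transient_S_minus[OF assms(1)]])
  have "level_one_formula lam p \<alpha> S w \<omega> v* (\<mu> *\<^sub>R S - \<omega> *\<^sub>R mat 1) = - lam *\<^sub>R w"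
    using level_one_formula_def vec_mult_matrix_inv_iff[OF transient_invertible[OF transient_S_minus[OF assms(1)]]]
    by metis
  then show "level_one_formula lam p \<alpha> S w \<omega> v* (\<mu> *\<^sub>R S - \<omega> *\<^sub>R mat 1) \<le> 0"
    using assms lam_pos by (simp add: less_eq_vec_def)
qed

lemma top_formula_mult_Top:
  assumes "0 \<le> \<omega>"
  shows "top_formula lam p \<alpha> S w \<omega> v* Top \<omega> = join_vec (- lam *\<^sub>R w) 0"
  using vec_mult_matrix_inv_iff[OF transient_invertible[OF transient_Top[OF assms]]]
  by (metis top_formula_def)

lemma top_formula_nonneg:
  assumes "0 \<le> \<omega>" "0 \<le> w"
  shows "0 \<le> top_formula lam p \<alpha> S w \<omega>"
  by (rule transient_row_nonneg[OF transient_Top[OF assms(1)]])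
    (use assms lam_pos in \<open>simp add: top_formula_mult_Top flip: join_vec_0, simp add: less_eq_vec_def\<close>)

lemma top_formula_scaleR:
  "top_formula lam p \<alpha> S (c *\<^sub>R w) \<omega> = c *\<^sub>R top_formula lam p \<alpha> S w \<omega>"
proof -
  have "join_vec (- lam *\<^sub>R (c *\<^sub>R w)) 0 = c *\<^sub>R join_vec (- lam *\<^sub>R w) 0"
    by (simp add: join_vec_scaleR)
  then show ?thesis by (simp only: top_formula_def scaleR_vector_matrix_assoc)
qed

lemma level_one_formula_scaleR:
  "level_one_formula lam p \<alpha> S (c *\<^sub>R w) \<omega> = c *\<^sub>R level_one_formula lam p \<alpha> S w \<omega>"
proof -
  have "- lam *\<^sub>R (c *\<^sub>R w) = c *\<^sub>R (- lam *\<^sub>R w)" by simp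
  then show ?thesis by (simp only: level_one_formula_def scaleR_vector_matrix_assoc)
qed

lemma unnorm_0 [simp]: "unnorm m \<omega> 0 = \<alpha>"
  by (simp add: unnorm_def)

lemma unnorm_below: "q < m \<Longrightarrow> unnorm m \<omega> q = base q"
  by (simp add: unnorm_def)

lemma unnorm_top:
  "1 \<le> m \<Longrightarrow> join_vec (unnorm m \<omega> m) (unnorm m \<omega> (m + 1)) = top_formula lam p \<alpha> S (base (m - 1)) \<omega>"
  by (simp add: unnorm_def vec_sum_eq_iff)

lemma unnorm_level_one: "unnorm 0 \<omega> 1 = level_one_formula lam p \<alpha> S \<alpha> \<omega>"
  by (simp add: unnorm_def)

lemma unnorm_nonneg:
  assumes "0 \<le> \<omega>"
  shows "0 \<le> unnorm m \<omega> q"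
  using top_formula_nonneg[OF assms base_nonneg, of "m - 1"]
    level_one_formula_nonneg[OF assms alpha(1)] base_nonneg
  by (auto simp: unnorm_def vec_sum_le_iff less_eq_vec_def)

lemma mass_ge_1: "0 \<le> \<omega> \<Longrightarrow> 1 \<le> mass m \<omega>"
  unfolding mass_def using unnorm_nonneg[of \<omega> m]
  by (simp del: sum.cl_ivl_Suc add: sum_nonneg inner_nonneg_vec less_eq_vec_def)

text \<open>Uniqueness up to the factor \<open>x\<close>. The cut equations express the completions
  at the next level by the current one, which turns balance below \<open>m\<close> into the one-step
  recursion behind \<open>R\<close>; above that, the levels solve an invertible system.\<close>

lemma balanced_imp_unnorm:
  assumes \<omega>: "0 \<le> \<omega>" and L0: "L 0 = x *\<^sub>R \<alpha>" and bal: "balanced m \<omega> x L" and q: "q \<le> m + 1"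
  shows "L q = x *\<^sub>R unnorm m \<omega> q"
proof -
  have mid: "lam *\<^sub>R L q + \<mu> *\<^sub>R (L (Suc q) v* S) + (\<mu> * (L (Suc q + 1) \<bullet> s)) *\<^sub>R \<alpha> = lam *\<^sub>R L (Suc q)"
    if "Suc q < m" for q
    using bal that unfolding balanced_def by (metis Suc_eq_plus1 add_diff_cancel_right' le_add2)
  \<comment> \<open>Summed over the phases, the balance of a level is the difference of the cut
    equations above and below it.\<close>
  have cut: "\<mu> * (L (Suc q) \<bullet> s) = lam * (L q \<bullet> 1)" if "q < m" for q
    using that
  proof (induction q)
    case 0
    then show ?case using bal L0 by (simp add: balanced_def alpha)
  next
    case (Suc q)
    have "(lam *\<^sub>R L q + \<mu> *\<^sub>R (L (Suc q) v* S) + (\<mu> * (L (Suc q + 1) \<bullet> s)) *\<^sub>R \<alpha>) \<bullet> 1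
      = (lam *\<^sub>R L (Suc q)) \<bullet> 1"
      using mid[OF Suc.prems] by simp
    then show ?case using Suc by (simp add: inner_add_left inner_S_mult_1 alpha)
  qed
  have below: "L q = x *\<^sub>R base q" if "q < m \<or> q = 0" for q
    using that
  proof (induction q)
    case 0
    then show ?case by (simp add: L0)
  next
    case (Suc q)
    then have "lam *\<^sub>R L q + \<mu> *\<^sub>R (L (Suc q) v* S) + (lam * (L (Suc q) \<bullet> 1)) *\<^sub>R \<alpha> = lam *\<^sub>R L (Suc q)"
      using mid[of q] cut[of "Suc q"] by simp
    then have "L (Suc q) v* A = lam *\<^sub>R L q" by (simp add: vec_mult_A algebra_simps)
    then have "L (Suc q) = L q v* R" by (simp add: vec_mult_R)
    then show ?case using Suc by (simp add: base_Suc scaleR_vector_matrix_assoc)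
  qed
  show ?thesis
  proof (cases "m = 0")
    case True
    have "lam *\<^sub>R L 0 + \<mu> *\<^sub>R (L 1 v* S) = \<omega> *\<^sub>R L 1" using bal True by (simp add: balanced_def)
    then have "L 1 = level_one_formula lam p \<alpha> S (x *\<^sub>R \<alpha>) \<omega>"
      using level_one_formula_iff[OF \<omega>, of "L 1"] L0 by simp
    then have "L 1 = x *\<^sub>R unnorm m \<omega> 1"
      using unnorm_level_one True level_one_formula_scaleR by metis
    moreover have "q = 0 \<or> q = 1" using q True by auto
    ultimately show ?thesis using L0 by auto
  next
    case False
    then have "join_vec (L m) (L (m + 1)) = top_formula lam p \<alpha> S (L (m - 1)) \<omega>"
      using bal by (simp add: top_formula_iff[OF \<omega>] balanced_def)
    also have "\<dots> = x *\<^sub>R top_formula lam p \<alpha> S (base (m - 1)) \<omega>"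
      using below[of "m - 1"] False by (simp add: top_formula_scaleR)
    also have "\<dots> = join_vec (x *\<^sub>R unnorm m \<omega> m) (x *\<^sub>R unnorm m \<omega> (m + 1))"
      using False unnorm_top[of m \<omega>] by (metis join_vec_scaleR less_one not_le)
    finally have "L m = x *\<^sub>R unnorm m \<omega> m" "L (m + 1) = x *\<^sub>R unnorm m \<omega> (m + 1)" by simp_all
    moreover have "q < m \<or> q = m \<or> q = m + 1" using q by auto
    ultimately show ?thesis using below unnorm_below by auto
  qed
qed

lemma balanced_unnorm:
  assumes \<omega>: "0 \<le> \<omega>"
  shows "balanced m \<omega> 1 (unnorm m \<omega>)"
proof (cases "m = 0")
  case True
  let ?v = "unnorm 0 \<omega> 1"
  have e: "lam *\<^sub>R \<alpha> + \<mu> *\<^sub>R (?v v* S) = \<omega> *\<^sub>R ?v"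
    using level_one_formula_iff[OF \<omega>] unnorm_level_one by metis
  from arg_cong[OF this, of "\<lambda>v. v \<bullet> 1"]
  have "\<mu> * (?v \<bullet> s) + \<omega> * (?v \<bullet> 1) = lam"
    by (simp add: inner_add_left inner_S_mult_1 alpha)
  with e show ?thesis by (simp add: True balanced_def)
next
  case False
  let ?u = "unnorm m \<omega> m" and ?v = "unnorm m \<omega> (m + 1)" and ?w = "base (m - 1)"
  have top: "lam *\<^sub>R ?w + \<mu> *\<^sub>R (?u v* S) + (\<mu> * (?v \<bullet> s)) *\<^sub>R \<alpha> + \<omega> *\<^sub>R ?v = lam *\<^sub>R ?u"
    "lam *\<^sub>R ?u + \<mu> *\<^sub>R (?v v* S) = \<omega> *\<^sub>R ?v"
    using top_formula_iff[OF \<omega>, of ?u ?v ?w] unnorm_top[of m \<omega>] False by auto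
  \<comment> \<open>Adding the two equations cancels all flow between the top levels. This leaves
    the cut below level \<open>m\<close>, which the recursion for \<open>base\<close> does not
    supply.\<close>
  have "\<mu> * (?u \<bullet> s) = lam * (?w \<bullet> 1)"
    using arg_cong[OF top(1), of "\<lambda>v. v \<bullet> 1"] arg_cong[OF top(2), of "\<lambda>v. v \<bullet> 1"]
    by (simp add: inner_add_left inner_S_mult_1 alpha)
  then have cut: "\<mu> * (unnorm m \<omega> (Suc q) \<bullet> s) = lam * (base q \<bullet> 1)" if "q < m" for q
    using that flow_cut[OF base_Suc_mult_A, of q] unnorm_below[of "Suc q" m \<omega>]
    by (cases "Suc q = m") auto
  have mid: "lam *\<^sub>R unnorm m \<omega> (q - 1) + \<mu> *\<^sub>R (unnorm m \<omega> q v* S)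
      + (\<mu> * (unnorm m \<omega> (q + 1) \<bullet> s)) *\<^sub>R \<alpha> = lam *\<^sub>R unnorm m \<omega> q"
    if q: "1 \<le> q" "q < m" for q
  proof -
    obtain r where r: "q = Suc r" using q by (cases q) auto
    have "lam *\<^sub>R base r + \<mu> *\<^sub>R (base q v* S) + (lam * (base q \<bullet> 1)) *\<^sub>R \<alpha> = lam *\<^sub>R base q"
      using base_Suc_mult_A[of r] by (simp add: r vec_mult_A algebra_simps)
    then show ?thesis
      using cut[of q] q unnorm_below[of r m \<omega>] unnorm_below[of q m \<omega>] by (simp add: r)
  qed
  have "unnorm m \<omega> (m - 1) = ?w" using False by (simp add: unnorm_below)
  then show ?thesis
    using mid top cut[of 0] False unfolding balanced_def by (simp add: alpha)
qed

lemma balanced_scaleR: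
  assumes "balanced m \<omega> x L" and L': "\<And>q. q \<le> m + 1 \<Longrightarrow> L' q = c *\<^sub>R L q"
  shows "balanced m \<omega> (c * x) L'"
proof -
  have *: "c *\<^sub>R a = c *\<^sub>R b" if "a = b" for a b :: "real^'n" using that by simp
  from assms(1) have
    E0: "\<mu> * (L 1 \<bullet> s) + (if m = 0 then \<omega> * (L 1 \<bullet> 1) else 0) = lam * x"
    and E: "\<And>q. 1 \<le> q \<Longrightarrow> q < m \<Longrightarrow>
        lam *\<^sub>R L (q - 1) + \<mu> *\<^sub>R (L q v* S) + (\<mu> * (L (q + 1) \<bullet> s)) *\<^sub>R \<alpha> = lam *\<^sub>R L q"
    and T: "1 \<le> m \<Longrightarrow> lam *\<^sub>R L (m - 1) + \<mu> *\<^sub>R (L m v* S) + (\<mu> * (L (m + 1) \<bullet> s)) *\<^sub>R \<alpha>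
        + \<omega> *\<^sub>R L (m + 1) = lam *\<^sub>R L m"
    and V: "lam *\<^sub>R L m + \<mu> *\<^sub>R (L (m + 1) v* S) = \<omega> *\<^sub>R L (m + 1)"
    by (auto simp: balanced_def)
  show ?thesis
    unfolding balanced_def
  proof (intro conjI allI impI; (elim conjE)?)
    have "L' 1 = c *\<^sub>R L 1" by (rule L') simp
    then show "\<mu> * (L' 1 \<bullet> s) + (if m = 0 then \<omega> * (L' 1 \<bullet> 1) else 0) = lam * (c * x)"
      using arg_cong[OF E0, of "\<lambda>t. c * t"] by (auto simp: algebra_simps)
  next
    fix q assume "1 \<le> q" "q < m"
    then show "lam *\<^sub>R L' (q - 1) + \<mu> *\<^sub>R (L' q v* S) + (\<mu> * (L' (q + 1) \<bullet> s)) *\<^sub>R \<alpha> = lam *\<^sub>R L' q"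
      using *[OF E[of q]] by (simp add: L' scaleR_vector_matrix_assoc scaleR_add_right mult.left_commute mult.commute)
  next
    assume "1 \<le> m"
    then show "lam *\<^sub>R L' (m - 1) + \<mu> *\<^sub>R (L' m v* S) + (\<mu> * (L' (m + 1) \<bullet> s)) *\<^sub>R \<alpha>
        + \<omega> *\<^sub>R L' (m + 1) = lam *\<^sub>R L' m"
      using *[OF T] by (simp add: L' scaleR_vector_matrix_assoc scaleR_add_right mult.left_commute mult.commute)
  next
    show "lam *\<^sub>R L' m + \<mu> *\<^sub>R (L' (m + 1) v* S) = \<omega> *\<^sub>R L' (m + 1)"
      using *[OF V] by (simp add: L' scaleR_vector_matrix_assoc scaleR_add_right mult.left_commute mult.commute)
  qed
qed

section \<open>Normalization and the role of the total mass\<close>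

definition stat :: "nat \<Rightarrow> real \<Rightarrow> 'n qstate \<Rightarrow> real" where
  "stat m \<omega> x = (case x of Idle \<Rightarrow> 1 / mass m \<omega>
     | Busy q j \<Rightarrow> if 1 \<le> q \<and> q \<le> m + 1 then unnorm m \<omega> q $ j / mass m \<omega> else 0)"

text \<open>The definite description in \<open>stationary\<close> needs existence and uniqueness,
  hence an equivalence. Total mass 1 fixes the factor that the balance equations leave open.\<close>

lemma is_stationary_eq_stat:
  assumes \<omega>: "0 \<le> \<omega>"
  shows "is_stationary (queue_states (m + 1)) (rate m \<omega>) \<pi> \<longleftrightarrow> \<pi> = stat m \<omega>"
proof
  assume "is_stationary (queue_states (m + 1)) (rate m \<omega>) \<pi>"
  then have supp: "\<And>x. x \<notin> queue_states (m + 1) \<Longrightarrow> \<pi> x = 0"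
    and tot: "\<pi> Idle + (\<Sum>q=1..m+1. level \<pi> q \<bullet> 1) = 1"
    and bal: "balanced m \<omega> (\<pi> Idle) (level \<pi>)"
    unfolding is_stationary_iff by auto
  have L: "level \<pi> q = \<pi> Idle *\<^sub>R unnorm m \<omega> q" if "q \<le> m + 1" for q
    by (rule balanced_imp_unnorm[OF \<omega> _ bal that]) (simp add: level_def)
  have "\<pi> Idle * mass m \<omega> = 1"
    using tot by (simp add: mass_def L sum_distrib_left distrib_left)
  then have Idle: "\<pi> Idle = 1 / mass m \<omega>" using mass_ge_1[OF \<omega>, of m] by (simp add: field_simps)
  have "\<pi> x = stat m \<omega> x" for x
  proof (cases x)
    case (Busy q j)
    show ?thesis
    proof (cases "1 \<le> q \<and> q \<le> m + 1")
      case True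
      then have "\<pi> (Busy q j) = level \<pi> q $ j" by (simp add: level_def)
      then show ?thesis using True Busy by (simp add: L stat_def Idle)
    next
      case False
      then show ?thesis using supp[of x] Busy by (auto simp: queue_states_def stat_def)
    qed
  qed (simp add: Idle stat_def)
  then show "\<pi> = stat m \<omega>" by blast
next
  assume \<pi>: "\<pi> = stat m \<omega>"
  have Z: "1 \<le> mass m \<omega>" by (rule mass_ge_1[OF \<omega>])
  have L: "level (stat m \<omega>) q = (1 / mass m \<omega>) *\<^sub>R unnorm m \<omega> q" if "q \<le> m + 1" for q
    using that by (auto simp: level_def stat_def vec_eq_iff)
  have Idle: "stat m \<omega> Idle = 1 / mass m \<omega>" by (simp add: stat_def)
  have "0 \<le> stat m \<omega> x" for x
    using Z unnorm_nonneg[OF \<omega>] by (auto simp: stat_def less_eq_vec_def split: qstate.split)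
  moreover have "stat m \<omega> x = 0" if "x \<notin> queue_states (m + 1)" for x
    using that by (cases x) (auto simp: stat_def queue_states_def)
  moreover have "stat m \<omega> Idle + (\<Sum>q=1..m+1. level (stat m \<omega>) q \<bullet> 1) = 1"
  proof -
    have "stat m \<omega> Idle + (\<Sum>q=1..m+1. level (stat m \<omega>) q \<bullet> 1)
      = (1 / mass m \<omega>) * mass m \<omega>"
      unfolding Idle using L by (simp add: mass_def distrib_left sum_distrib_left del: mult_cancel_left1)
    then show ?thesis using Z by simp
  qed
  moreover have "balanced m \<omega> (1 / mass m \<omega> * 1) (level (stat m \<omega>))"
    by (rule balanced_scaleR[OF balanced_unnorm[OF \<omega>] L])
  ultimately show "is_stationary (queue_states (m + 1)) (rate m \<omega>) \<pi>"
    unfolding \<pi> is_stationary_iff by (simp add: Idle)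
qed

lemma pool_stat_eq:
  assumes "0 \<le> \<omega>"
  shows "pool_stat lam p \<alpha> S m \<omega> = stat m \<omega>"
proof -
  have "pool_stat lam p \<alpha> S m \<omega> = stationary (queue_states (m + 1)) (rate m \<omega>)"
    by (simp add: pool_stat_def rate_def[abs_def])
  then show ?thesis by (simp add: stationary_def is_stationary_eq_stat[OF assms, unfolded Suc_eq_plus1[symmetric]])
qed

lemma pool_idle_eq: "0 \<le> \<omega> \<Longrightarrow> pool_idle lam p \<alpha> S m \<omega> = 1 / mass m \<omega>"
  by (simp add: pool_idle_def pool_stat_eq stat_def)

lemma pool_level_eq:
  "0 \<le> \<omega> \<Longrightarrow> q \<le> m + 1 \<Longrightarrow>
    pool_level lam p \<alpha> S m \<omega> q = pool_idle lam p \<alpha> S m \<omega> *\<^sub>R unnorm m \<omega> q"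
  by (auto simp: pool_level_def pool_idle_eq) (simp add: pool_stat_eq stat_def vec_eq_iff)

text \<open>At rate 0 the additional transition disappears, and the chain with top level
  \<open>m + 1\<close> is a finite queue.\<close>

lemma mph1_idle_Suc: "mph1_idle lam p \<alpha> S (Suc m) = 1 / mass m 0"
proof -
  have "omega_rate m 0 x y = 0" for x y :: "'n qstate"
    by (cases x; cases y) auto
  then have "mph1_idle lam p \<alpha> S (Suc m) = pool_idle lam p \<alpha> S m 0"
    by (simp add: mph1_idle_def pool_idle_def pool_stat_def)
  then show ?thesis by (simp add: pool_idle_eq)
qed

lemma mass_0: "mass 0 \<omega> = 1 + level_one_formula lam p \<alpha> S \<alpha> \<omega> \<bullet> 1"
  using unnorm_level_one[of \<omega>] by (simp add: mass_def)

lemma mass_Suc: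
  "mass (Suc k) \<omega> = 1 + (\<Sum>q=1..k. base q \<bullet> 1) + top_formula lam p \<alpha> S (base k) \<omega> \<bullet> 1"
proof -
  let ?m = "Suc k"
  have "(\<Sum>q=1..?m+1. unnorm ?m \<omega> q \<bullet> 1)
      = (\<Sum>q=1..k. unnorm ?m \<omega> q \<bullet> 1) + (unnorm ?m \<omega> ?m \<bullet> 1 + unnorm ?m \<omega> (?m + 1) \<bullet> 1)"
    by simp
  also have "(\<Sum>q=1..k. unnorm ?m \<omega> q \<bullet> 1) = (\<Sum>q=1..k. base q \<bullet> 1)"
    by (intro sum.cong) (simp_all add: unnorm_below)
  also have "unnorm ?m \<omega> ?m \<bullet> 1 + unnorm ?m \<omega> (?m + 1) \<bullet> 1 = top_formula lam p \<alpha> S (base k) \<omega> \<bullet> 1"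
    using unnorm_top[of ?m \<omega>]
      join_vec_inner[of "unnorm ?m \<omega> ?m" "unnorm ?m \<omega> (?m + 1)" 1 1] by (simp add: join_vec_1)
  finally show ?thesis unfolding mass_def by simp
qed

text \<open>The formulas for the top levels are linear in the level that feeds them, so the
  prescribed idle probability factors out. Hence computed mass 1 and the prescribed idle probability
  are the same equation for \<open>mass m \<omega>\<close>.\<close>

lemma computed_mass_eq: "computed_mass lam p \<alpha> S m \<omega> = (1 - lam) / (1 - p) * mass m \<omega>"
proof -
  let ?c = "(1 - lam) / (1 - p)"
  have lf: "level_formula lam p \<alpha> S q = ?c *\<^sub>R base q" for q
    by (simp add: level_formula_def base_def)
  show ?thesis
  proof (cases m)
    case 0
    then show ?thesis
      unfolding computed_mass_def lf level_one_formula_scaleR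
      by (simp add: mass_0 distrib_left)
  next
    case (Suc k)
    then show ?thesis
      unfolding computed_mass_def lf top_formula_scaleR
      by (simp add: mass_Suc distrib_left sum_distrib_left)
  qed
qed

section \<open>Dependence of the total mass on the rate\<close>

text \<open>Emptiness would propagate downwards: balance at \<open>m + 1\<close> empties level
  \<open>m\<close>, and balance at \<open>m\<close> the level below, which is a nonzero
  \<open>base\<close> level. For \<open>m = 0\<close> the first step already contradicts \<alpha>
  \<noteq> 0.\<close>

lemma top_level_nonzero:
  assumes \<omega>: "0 \<le> \<omega>"
  shows "unnorm m \<omega> (m + 1) \<noteq> 0"
proof
  assume v: "unnorm m \<omega> (m + 1) = 0"
  have bal: "balanced m \<omega> 1 (unnorm m \<omega>)" by (rule balanced_unnorm[OF \<omega>])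
  then have u: "unnorm m \<omega> m = 0" using v lam_pos by (simp add: balanced_def)
  show False
  proof (cases "m = 0")
    case True
    then show False using u base_nonzero[of 0] by (metis base_0 unnorm_0)
  next
    case False
    then have "unnorm m \<omega> (m - 1) = 0" using bal u v lam_pos by (simp add: balanced_def)
    then show False using False base_nonzero by (simp add: unnorm_below)
  qed
qed

text \<open>With the mean times \<open>h\<close> at rate \<omega>, testing the balance equation at
  \<omega>' against \<open>h\<close> yields an expression for \<open>lam * (w \<bullet> h)\<close>,
  which is free of \<omega>'; it is compared with the case \<omega>' = \<omega>. Choosing
  \<open>d\<close> before \<omega>' permits bounds uniform in \<omega>'.\<close>

lemma level_one_difference:
  assumes \<omega>: "0 \<le> \<omega>"
  shows "\<exists>d. (\<forall>i. 0 < d $ i) \<and> (\<forall>\<omega>'\<ge>0.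
    level_one_formula lam p \<alpha> S w \<omega> \<bullet> 1 - level_one_formula lam p \<alpha> S w \<omega>' \<bullet> 1
      = (\<omega>' - \<omega>) * (level_one_formula lam p \<alpha> S w \<omega>' \<bullet> d))"
proof -
  define h where "h = matrix_inv (\<mu> *\<^sub>R S - \<omega> *\<^sub>R mat 1) *v (- 1)"
  have h: "(\<mu> *\<^sub>R S - \<omega> *\<^sub>R mat 1) *v h = - 1"
    unfolding h_def by (rule matrix_inv_mult_vec[OF transient_invertible[OF transient_S_minus[OF \<omega>]]])
  have Sh: "\<mu> *\<^sub>R (S *v h) = \<omega> *\<^sub>R h - 1"
    using h by (simp add: matrix_vector_mult_diff_rdistrib algebra_simps flip: scaleR_matrix_vector_assoc)
  have eq: "lam * (w \<bullet> h) = y \<bullet> 1 + (\<omega>' - \<omega>) * (y \<bullet> h)"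
    if "0 \<le> \<omega>'" "y = level_one_formula lam p \<alpha> S w \<omega>'" for \<omega>' y
  proof -
    have "lam *\<^sub>R w + \<mu> *\<^sub>R (y v* S) = \<omega>' *\<^sub>R y"
      using level_one_formula_iff[OF that(1)] that(2) by blast
    from arg_cong[OF this, of "\<lambda>v. v \<bullet> h"]
    have "lam * (w \<bullet> h) + y \<bullet> (\<mu> *\<^sub>R (S *v h)) = \<omega>' * (y \<bullet> h)"
      by (simp add: inner_add_left dot_lmul_matrix)
    then show ?thesis unfolding Sh by (simp add: inner_diff_right algebra_simps)
  qed
  have "0 < h $ i" for i by (rule transient_mean_time_pos[OF transient_S_minus[OF \<omega>] h])
  moreover have "level_one_formula lam p \<alpha> S w \<omega> \<bullet> 1 - level_one_formula lam p \<alpha> S w \<omega>' \<bullet> 1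
      = (\<omega>' - \<omega>) * (level_one_formula lam p \<alpha> S w \<omega>' \<bullet> h)" if "0 \<le> \<omega>'" for \<omega>'
    using eq[OF \<omega> refl] eq[OF that refl] by simp
  ultimately show ?thesis by blast
qed

text \<open>
  \<open>h1\<close> and \<open>h2\<close> are the mean times until the queue leaves its two top levels, from the lower and
  from the upper one. Coupling the two starts shows that \<open>h2 - h1\<close> is \<open>\<alpha> \<bullet> h1\<close> times the
  probability that the service ends before the next arrival or \<open>\<omega>\<close>-transition.
\<close>

lemma top_difference:
  assumes \<omega>: "0 \<le> \<omega>"
  shows "\<exists>d. (\<forall>i. 0 < d $ i) \<and> (\<forall>\<omega>'\<ge>0. \<forall>u v. join_vec u v = top_formula lam p \<alpha> S w \<omega>' \<longrightarrow>
    top_formula lam p \<alpha> S w \<omega> \<bullet> 1 - top_formula lam p \<alpha> S w \<omega>' \<bullet> 1 = (\<omega>' - \<omega>) * (v \<bullet> d))"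
proof -
  define h where "h = matrix_inv (Top \<omega>) *v (- 1)"
  have h: "Top \<omega> *v h = - 1"
    unfolding h_def by (rule matrix_inv_mult_vec[OF transient_invertible[OF transient_Top[OF \<omega>]]])
  have h_pos: "0 < h $ i" for i by (rule transient_mean_time_pos[OF transient_Top[OF \<omega>] h])
  obtain h1 h2 where hj: "h = join_vec h1 h2" using join_vec_surj by blast
  have h1_pos: "0 < h1 $ i" for i using h_pos[of "Inl i"] by (simp add: hj)
  have "Top \<omega> *v join_vec h1 h2 = join_vec (- 1) (- 1)"
    using h hj by (simp add: join_vec_1 flip: join_vec_minus)
  then have Sh1: "\<mu> *\<^sub>R (S *v h1) = lam *\<^sub>R h1 - lam *\<^sub>R h2 - 1"
    and Sh2: "\<mu> *\<^sub>R (S *v h2) = \<omega> *\<^sub>R h2 - \<omega> *\<^sub>R h1 - (\<mu> * (\<alpha> \<bullet> h1)) *\<^sub>R s - 1"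
    by (simp_all add: top_block_def block_mult_join_vec matrix_vector_mult_diff_rdistrib
        matrix_vector_mult_add_rdistrib col_row_mult_vec flip: scaleR_matrix_vector_assoc)
       (simp_all add: vec_eq_iff algebra_simps)
  have "0 < \<alpha> \<bullet> h1"
    by (rule inner_pos_vec[OF alpha(1) _ h1_pos]) (use alpha(2) in auto)
  then have "0 < \<mu> * (\<alpha> \<bullet> h1)" using mu_pos by simp
  \<comment> \<open>Apart from constants and the completion term, \<open>Sh1\<close> and
    \<open>Sh2\<close> involve only \<open>h2 - h1\<close> on the right, so subtracting them gives a
    closed equation.\<close>
  moreover have "(\<mu> *\<^sub>R S - (\<omega> + lam) *\<^sub>R mat 1) *v (h2 - h1) = - (\<mu> * (\<alpha> \<bullet> h1)) *\<^sub>R s"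
  proof -
    have "(\<mu> *\<^sub>R S - (\<omega> + lam) *\<^sub>R mat 1) *v (h2 - h1)
      = \<mu> *\<^sub>R (S *v h2) - \<mu> *\<^sub>R (S *v h1) - (\<omega> + lam) *\<^sub>R (h2 - h1)"
      by (simp add: matrix_vector_mult_diff_rdistrib matrix_vector_mult_diff_distrib
          scaleR_diff_right flip: scaleR_matrix_vector_assoc)
    then show ?thesis unfolding Sh1 Sh2 by (simp add: vec_eq_iff algebra_simps)
  qed
  ultimately have pos: "0 < (h2 - h1) $ i" for i
    by (rule transient_transform_pos[OF transient_S mu_pos add_nonneg_nonneg[OF \<omega> less_imp_le[OF lam_pos]]])
  \<comment> \<open>The left side does not involve \<omega>', so the right sides at \<omega> and
    \<omega>' agree.\<close>
  have eq: "lam * (w \<bullet> h1) = u \<bullet> 1 + v \<bullet> 1 + (\<omega>' - \<omega>) * (v \<bullet> (h2 - h1))"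
    if "0 \<le> \<omega>'" "join_vec u v = top_formula lam p \<alpha> S w \<omega>'" for \<omega>' u v
  proof -
    have e: "lam *\<^sub>R w + \<mu> *\<^sub>R (u v* S) + (\<mu> * (v \<bullet> s)) *\<^sub>R \<alpha> + \<omega>' *\<^sub>R v = lam *\<^sub>R u"
      "lam *\<^sub>R u + \<mu> *\<^sub>R (v v* S) = \<omega>' *\<^sub>R v"
      using top_formula_iff[OF that(1)] that(2) by blast+
    have "lam * (w \<bullet> h1) + u \<bullet> (\<mu> *\<^sub>R (S *v h1)) + \<mu> * (v \<bullet> s) * (\<alpha> \<bullet> h1) + \<omega>' * (v \<bullet> h1) = lam * (u \<bullet> h1)"
      using arg_cong[OF e(1), of "\<lambda>v. v \<bullet> h1"] by (simp add: inner_add_left dot_lmul_matrix)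
    moreover have "lam * (u \<bullet> h2) + v \<bullet> (\<mu> *\<^sub>R (S *v h2)) = \<omega>' * (v \<bullet> h2)"
      using arg_cong[OF e(2), of "\<lambda>v. v \<bullet> h2"] by (simp add: inner_add_left dot_lmul_matrix)
    ultimately show ?thesis unfolding Sh1 Sh2 by (simp add: inner_diff_right algebra_simps)
  qed
  have sum1: "join_vec u v \<bullet> 1 = u \<bullet> 1 + v \<bullet> 1" for u v :: "real^'n"
    by (simp add: join_vec_inner flip: join_vec_1)
  obtain u0 v0 where j0: "join_vec u0 v0 = top_formula lam p \<alpha> S w \<omega>" using join_vec_surj by metis
  have "top_formula lam p \<alpha> S w \<omega> \<bullet> 1 - top_formula lam p \<alpha> S w \<omega>' \<bullet> 1 = (\<omega>' - \<omega>) * (v \<bullet> (h2 - h1))"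
    if "0 \<le> \<omega>'" and j: "join_vec u v = top_formula lam p \<alpha> S w \<omega>'" for \<omega>' u v
    using eq[OF \<omega> j0] eq[OF that] sum1[of u0 v0] sum1[of u v] unfolding j0 j by simp
  then show ?thesis using pos by blast
qed

lemma mass_difference:
  assumes \<omega>: "0 \<le> \<omega>"
  shows "\<exists>d. (\<forall>i. 0 < d $ i) \<and>
    (\<forall>\<omega>'\<ge>0. mass m \<omega> - mass m \<omega>' = (\<omega>' - \<omega>) * (unnorm m \<omega>' (m + 1) \<bullet> d))"
proof (cases m)
  case 0
  then show ?thesis
    using level_one_difference[OF \<omega>, of \<alpha>] unnorm_level_one by (simp add: mass_0)
next
  case (Suc k)
  obtain d where d: "\<And>i. 0 < d $ i" "\<And>\<omega>' u v. 0 \<le> \<omega>' \<Longrightarrow>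
      join_vec u v = top_formula lam p \<alpha> S (base k) \<omega>' \<Longrightarrow>
      top_formula lam p \<alpha> S (base k) \<omega> \<bullet> 1 - top_formula lam p \<alpha> S (base k) \<omega>' \<bullet> 1
        = (\<omega>' - \<omega>) * (v \<bullet> d)"
    using top_difference[OF \<omega>, of "base k"] by blast
  have "mass m \<omega> - mass m \<omega>' = (\<omega>' - \<omega>) * (unnorm m \<omega>' (m + 1) \<bullet> d)" if "0 \<le> \<omega>'" for \<omega>'
    using d(2)[OF that, of "unnorm m \<omega>' m" "unnorm m \<omega>' (m + 1)"] unnorm_top[of m \<omega>']
    by (simp add: Suc mass_Suc)
  with d(1) show ?thesis by blast
qed

lemma mass_strict_antimono:
  assumes "0 \<le> \<omega>" "\<omega> < \<omega>'"
  shows "mass m \<omega>' < mass m \<omega>"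
proof -
  obtain d where d: "\<And>i. 0 < d $ i"
    "\<And>\<omega>'. 0 \<le> \<omega>' \<Longrightarrow> mass m \<omega> - mass m \<omega>' = (\<omega>' - \<omega>) * (unnorm m \<omega>' (m + 1) \<bullet> d)"
    using mass_difference[OF assms(1)] by blast
  have "0 \<le> \<omega>'" using assms by simp
  then have "0 < unnorm m \<omega>' (m + 1) \<bullet> d"
    by (intro inner_pos_vec unnorm_nonneg top_level_nonzero d)
  then have "0 < (\<omega>' - \<omega>) * (unnorm m \<omega>' (m + 1) \<bullet> d)" using assms by simp
  then show ?thesis using d(2)[OF \<open>0 \<le> \<omega>'\<close>] by simp
qed

lemma mass_le_mass_0: "0 \<le> \<omega> \<Longrightarrow> mass m \<omega> \<le> mass m 0"
  using mass_strict_antimono[of 0 \<omega> m] by (cases "\<omega> = 0") auto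

lemma level_le_mass:
  assumes \<omega>: "0 \<le> \<omega>" and "q \<le> m + 1"
  shows "unnorm m \<omega> q \<bullet> 1 \<le> mass m \<omega>"
proof (cases "q = 0")
  case True
  then show ?thesis using mass_ge_1[OF \<omega>] by (simp add: alpha)
next
  case False
  have nn: "0 \<le> unnorm m \<omega> q \<bullet> 1" for q
    by (rule inner_nonneg_vec[OF unnorm_nonneg[OF \<omega>]]) (simp add: less_eq_vec_def)
  have "unnorm m \<omega> q \<bullet> 1 \<le> (\<Sum>q=1..m+1. unnorm m \<omega> q \<bullet> 1)"
    by (rule member_le_sum) (use False assms nn in auto)
  then show ?thesis by (simp add: mass_def)
qed

lemma inner_le_sum:
  fixes x d :: "real^'n"
  assumes "0 \<le> x" "0 \<le> d"
  shows "x \<bullet> d \<le> (d \<bullet> 1) * (x \<bullet> 1)"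
proof -
  have "d \<le> (d \<bullet> 1) *\<^sub>R 1"
    using assms(2) by (auto simp: less_eq_vec_def inner_one_vec intro: member_le_sum)
  from inner_mono_vec[OF assms(1) this] show ?thesis by simp
qed

text \<open>A Lipschitz bound around each \<omega>: \<open>d\<close> depends on \<omega> alone, and
  by monotonicity the top level at any \<omega>' has mass at most \<open>mass m 0\<close>.\<close>

lemma continuous_on_mass: "continuous_on {0..} (mass m)"
  unfolding continuous_on_eq_continuous_within
proof
  fix \<omega> :: real assume "\<omega> \<in> {0..}"
  then have \<omega>: "0 \<le> \<omega>" by simp
  obtain d where d: "\<And>i. 0 < d $ i"
    "\<And>\<omega>'. 0 \<le> \<omega>' \<Longrightarrow> mass m \<omega> - mass m \<omega>' = (\<omega>' - \<omega>) * (unnorm m \<omega>' (m + 1) \<bullet> d)"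
    using mass_difference[OF \<omega>] by blast
  have d0: "0 \<le> d" using d(1) by (simp add: less_eq_vec_def less_imp_le)
  define C where "C = (d \<bullet> 1) * mass m 0"
  have d1: "0 \<le> d \<bullet> 1" by (rule inner_nonneg_vec[OF d0]) (simp add: less_eq_vec_def)
  have bound: "norm (mass m \<omega>' - mass m \<omega>) \<le> C * \<bar>\<omega>' - \<omega>\<bar>" if "0 \<le> \<omega>'" for \<omega>'
  proof -
    let ?v = "unnorm m \<omega>' (m + 1)"
    have v: "0 \<le> ?v" by (rule unnorm_nonneg[OF that])
    have "?v \<bullet> d \<le> (d \<bullet> 1) * (?v \<bullet> 1)" by (rule inner_le_sum[OF v d0])
    also have "\<dots> \<le> C" unfolding C_def
      using level_le_mass[OF that, of "m + 1" m] mass_le_mass_0[OF that, of m] d1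
      by (intro mult_left_mono) auto
    finally have "?v \<bullet> d \<le> C" .
    moreover have "norm (mass m \<omega>' - mass m \<omega>) = \<bar>\<omega>' - \<omega>\<bar> * (?v \<bullet> d)"
      using d(2)[OF that] inner_nonneg_vec[OF v d0]
      by (metis abs_minus_commute abs_mult abs_of_nonneg real_norm_def)
    ultimately show ?thesis by (simp only: mult.commute[of C] mult_left_mono abs_ge_zero)
  qed
  have "((\<lambda>\<omega>'. mass m \<omega>' - mass m \<omega>) \<longlongrightarrow> 0) (at \<omega> within {0..})"
  proof (rule Lim_null_comparison)
    show "\<forall>\<^sub>F \<omega>' in at \<omega> within {0..}. norm (mass m \<omega>' - mass m \<omega>) \<le> C * \<bar>\<omega>' - \<omega>\<bar>"
      using bound by (auto simp: eventually_at_filter)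
    have "((\<lambda>\<omega>'. C * \<bar>\<omega>' - \<omega>\<bar>) \<longlongrightarrow> C * \<bar>\<omega> - \<omega>\<bar>) (at \<omega> within {0..})"
      by (intro tendsto_intros)
    then show "((\<lambda>\<omega>'. C * \<bar>\<omega>' - \<omega>\<bar>) \<longlongrightarrow> 0) (at \<omega> within {0..})" by simp
  qed
  then show "continuous (at \<omega> within {0..}) (mass m)"
    unfolding continuous_within by (rule LIM_zero_cancel)
qed

text \<open>Summed over the phases, the balance of level \<open>m + 1\<close> bounds its outflow at
  rate \<omega> by the arrivals from level \<open>m\<close>.\<close>

lemma top_level_le:
  assumes \<omega>: "0 < \<omega>"
  shows "unnorm m \<omega> (m + 1) \<bullet> 1 \<le> lam * mass m 0 / \<omega>"
proof -
  let ?v = "unnorm m \<omega> (m + 1)"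
  have "lam *\<^sub>R unnorm m \<omega> m + \<mu> *\<^sub>R (?v v* S) = \<omega> *\<^sub>R ?v"
    using balanced_unnorm[of \<omega> m] \<omega> by (simp add: balanced_def)
  from arg_cong[OF this, of "\<lambda>v. v \<bullet> 1"]
  have "\<omega> * (?v \<bullet> 1) = lam * (unnorm m \<omega> m \<bullet> 1) - \<mu> * (?v \<bullet> s)"
    by (simp add: inner_add_left inner_S_mult_1)
  also have "\<dots> \<le> lam * (unnorm m \<omega> m \<bullet> 1)"
    using mu_pos inner_nonneg_vec[OF unnorm_nonneg s_nonneg, of \<omega> m "m + 1"] \<omega> by simp
  also have "\<dots> \<le> lam * mass m 0"
    using level_le_mass[of \<omega> m m] mass_le_mass_0[of \<omega> m] \<omega> lam_pos by simp
  finally show ?thesis using \<omega> by (simp add: field_simps)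
qed

section \<open>Comparison with the queue with room for \<open>m\<close> jobs\<close>

definition service_time :: "real^'n" where
  "service_time = matrix_inv (\<mu> *\<^sub>R S) *v (- 1)"

lemma S_mult_service_time: "\<mu> *\<^sub>R (S *v service_time) = - 1"
proof -
  have "invertible (\<mu> *\<^sub>R S)" using transient_invertible[OF transient_S_minus[of 0]] by simp
  from matrix_inv_mult_vec[OF this, of "- 1"] show ?thesis
    by (simp add: service_time_def scaleR_matrix_vector_assoc)
qed

text \<open>\<open>service_time\<close> holds the mean remaining service times by phase at speed
  \<open>1 - p\<close>. Testing a balance equation against it turns the \<open>S\<close>-term into
  the mass of the level.\<close>

lemma inner_service_time: "\<mu> * ((x v* S) \<bullet> service_time) = - (x \<bullet> 1)"
  using arg_cong[OF S_mult_service_time, of "\<lambda>v. x \<bullet> v"] by (simp add: dot_lmul_matrix)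

text \<open>At rate 0 the completions at the last level equal the arrivals from below, just as in
  the recursion for \<open>base\<close>. So blocking changes only the last level.\<close>

lemma top_formula_base_0:
  "top_formula lam p \<alpha> S (base k) 0
    = join_vec (base (Suc k)) (level_one_formula lam p \<alpha> S (base (Suc k)) 0)"
proof -
  let ?v = "level_one_formula lam p \<alpha> S (base (Suc k)) 0"
  have v: "lam *\<^sub>R base (Suc k) + \<mu> *\<^sub>R (?v v* S) = 0"
    using level_one_formula_iff[of 0] by force
  from arg_cong[OF this, of "\<lambda>v. v \<bullet> 1"] have "\<mu> * (?v \<bullet> s) = lam * (base (Suc k) \<bullet> 1)"
    by (simp add: inner_add_left inner_S_mult_1)
  then have "lam *\<^sub>R base k + \<mu> *\<^sub>R (base (Suc k) v* S) + (\<mu> * (?v \<bullet> s)) *\<^sub>R \<alpha> = lam *\<^sub>R base (Suc k)"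
    using base_Suc_mult_A[of k] by (simp only: vec_mult_A) (simp add: algebra_simps)
  then have "join_vec (base (Suc k)) ?v = top_formula lam p \<alpha> S (base k) 0"
    using v by (subst top_formula_iff) auto
  then show ?thesis by simp
qed

text \<open>Only the last level is not a \<open>base\<close> level; its mass comes from testing its
  balance equation against \<open>service_time\<close>.\<close>

lemma mass_at_0:
  "mass k 0 = 1 + (\<Sum>q=1..k. base q \<bullet> 1) + lam * (base k \<bullet> service_time)"
proof -
  have v: "level_one_formula lam p \<alpha> S w 0 \<bullet> 1 = lam * (w \<bullet> service_time)" for w
  proof -
    let ?v = "level_one_formula lam p \<alpha> S w 0"
    have "lam *\<^sub>R w + \<mu> *\<^sub>R (?v v* S) = 0" using level_one_formula_iff[of 0] by force
    from arg_cong[OF this, of "\<lambda>v. v \<bullet> service_time"] show ?thesis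
      by (simp add: inner_add_left inner_service_time)
  qed
  show ?thesis
  proof (cases k)
    case 0
    then show ?thesis by (simp add: mass_0 v)
  next
    case (Suc l)
    then show ?thesis
      using join_vec_inner[of "base k" _ 1 1]
      by (simp add: mass_Suc top_formula_base_0 join_vec_1 v)
  qed
qed

text \<open>\<open>mass k 0\<close> belongs to the queue with room for \<open>Suc k\<close> jobs.
  Testing both top equations against \<open>service_time\<close> and adding them cancels the
  \<omega>-terms and the arrivals between the top levels; the excess comes from services started
  after completions at the upper level.\<close>

lemma mass_Suc_excess:
  assumes "0 \<le> \<omega>"
  shows "mass (Suc k) \<omega>
    = mass k 0 + \<mu> * (unnorm (Suc k) \<omega> (Suc k + 1) \<bullet> s) * (\<alpha> \<bullet> service_time)"
proof -
  let ?u = "unnorm (Suc k) \<omega> (Suc k)" and ?v = "unnorm (Suc k) \<omega> (Suc k + 1)"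
  have j: "join_vec ?u ?v = top_formula lam p \<alpha> S (base k) \<omega>"
    using unnorm_top[of "Suc k" \<omega>] by simp
  have e: "lam *\<^sub>R base k + \<mu> *\<^sub>R (?u v* S) + (\<mu> * (?v \<bullet> s)) *\<^sub>R \<alpha> + \<omega> *\<^sub>R ?v = lam *\<^sub>R ?u"
      "lam *\<^sub>R ?u + \<mu> *\<^sub>R (?v v* S) = \<omega> *\<^sub>R ?v"
    using top_formula_iff[OF assms] j by blast+
  have "?u \<bullet> 1 + ?v \<bullet> 1 = lam * (base k \<bullet> service_time) + \<mu> * (?v \<bullet> s) * (\<alpha> \<bullet> service_time)"
    using arg_cong[OF e(1), of "\<lambda>v. v \<bullet> service_time"] arg_cong[OF e(2), of "\<lambda>v. v \<bullet> service_time"]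
    by (simp add: inner_add_left inner_service_time)
  moreover have "top_formula lam p \<alpha> S (base k) \<omega> \<bullet> 1 = ?u \<bullet> 1 + ?v \<bullet> 1"
    using join_vec_inner[of ?u ?v 1 1] unfolding j join_vec_1 .
  ultimately show ?thesis by (simp add: mass_Suc mass_at_0)
qed

lemma mph1_idle_0: "mph1_idle lam p \<alpha> S 0 = 1"
proof -
  have X: "queue_states 0 = {Idle}" by (auto simp: queue_states_def)
  have "is_stationary {Idle} (mph1_rate lam p \<alpha> S) \<pi> \<longleftrightarrow> \<pi> = (\<lambda>x. if x = Idle then 1 else 0)" for \<pi>
    by (auto simp: is_stationary_def)
  then show ?thesis by (simp add: mph1_idle_def stationary_def X)
qed

text \<open>The reciprocal idle probability is the total mass of the queue with room for
  \<open>m\<close> jobs. The excess over it is at most a constant times the mass of the top level,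
  hence O(1/\<omega>); for \<open>m = 0\<close> it is that mass itself.\<close>

lemma mass_upper_bound:
  "\<exists>C\<ge>0. \<forall>\<omega>>0. mass m \<omega> \<le> 1 / mph1_idle lam p \<alpha> S m + C / \<omega>"
proof (cases m)
  case 0
  have "mass 0 \<omega> \<le> 1 + lam * mass 0 0 / \<omega>" if "0 < \<omega>" for \<omega>
    using top_level_le[OF that, of 0] by (simp add: mass_def)
  then show ?thesis
    using lam_pos mass_ge_1[of 0 0] by (intro exI[of _ "lam * mass 0 0"]) (auto simp: 0 mph1_idle_0)
next
  case (Suc k)
  define D where "D = \<mu> * (s \<bullet> 1) * (\<alpha> \<bullet> service_time)"
  have st: "0 \<le> service_time"
    using transient_min_principle[OF transient_S_minus[of 0], of service_time] S_mult_service_time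
    by (simp add: scaleR_matrix_vector_assoc less_eq_vec_def)
  have s1: "0 \<le> s \<bullet> 1" by (rule inner_nonneg_vec[OF s_nonneg]) (simp add: less_eq_vec_def)
  have D: "0 \<le> D" unfolding D_def using mu_pos s1 inner_nonneg_vec[OF alpha(1) st] by simp
  have "mass m \<omega> \<le> 1 / mph1_idle lam p \<alpha> S m + D * (lam * mass m 0) / \<omega>" if \<omega>: "0 < \<omega>" for \<omega>
  proof -
    let ?v = "unnorm m \<omega> (m + 1)"
    have v: "0 \<le> ?v" using \<omega> by (simp add: unnorm_nonneg)
    have "?v \<bullet> s \<le> (s \<bullet> 1) * (?v \<bullet> 1)" by (rule inner_le_sum[OF v s_nonneg])
    then have "\<mu> * (?v \<bullet> s) * (\<alpha> \<bullet> service_time) \<le> \<mu> * ((s \<bullet> 1) * (?v \<bullet> 1)) * (\<alpha> \<bullet> service_time)"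
      using mu_pos inner_nonneg_vec[OF alpha(1) st] by (intro mult_left_mono mult_right_mono) auto
    also have "\<dots> = D * (?v \<bullet> 1)" by (simp add: D_def)
    also have "\<dots> \<le> D * (lam * mass m 0 / \<omega>)" by (rule mult_left_mono[OF top_level_le[OF \<omega>] D])
    finally show ?thesis using mass_Suc_excess[of \<omega> k] \<omega> by (simp add: Suc mph1_idle_Suc)
  qed
  then show ?thesis
    using D lam_pos mass_ge_1[of 0 m] by (intro exI[of _ "D * (lam * mass m 0)"]) auto
qed

end

text \<open>The invertibility claims make \<open>R_mat\<close> and the block formula meaningful, and
  the existence claim keeps the implication from being vacuous. For \<open>m = 0\<close> there is no
  pair of busy top levels, so level 1 has its own formula.\<close>

theorem theorem7p1:
  fixes lam p :: real and \<alpha> :: "real^'n" and S :: "real^'n^'n" and m :: nat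
  assumes "0 < p" and "p < lam" and "lam < 1"
    and "phase_type \<alpha> S" and "ph_mean \<alpha> S = 1"
    and "mph1_idle lam p \<alpha> S m > (1 - lam) / (1 - p)"
    and "\<And>k. mph1_idle lam p \<alpha> S k > (1 - lam) / (1 - p) \<Longrightarrow> k \<le> m"
  shows "invertible (R_denom lam p \<alpha> S)
    \<and> (\<forall>\<omega>\<ge>0. invertible (top_block lam p \<alpha> S \<omega>))
    \<and> (\<exists>\<omega>\<ge>0. pool_idle lam p \<alpha> S m \<omega> = (1 - lam) / (1 - p))
    \<and> (\<forall>\<omega>\<ge>0. pool_idle lam p \<alpha> S m \<omega> = (1 - lam) / (1 - p) \<longrightarrow>
        (\<forall>q\<in>{1..m-1}. pool_level lam p \<alpha> S m \<omega> q
            = ((1 - lam) / (1 - p)) *\<^sub>R (\<alpha> v* mat_power (R_mat lam p \<alpha> S) q))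
      \<and> (1 \<le> m \<longrightarrow>
            join_vec (pool_level lam p \<alpha> S m \<omega> m) (pool_level lam p \<alpha> S m \<omega> (m + 1))
            = join_vec (- lam *\<^sub>R pool_level lam p \<alpha> S m \<omega> (m - 1)) 0
                v* matrix_inv (top_block lam p \<alpha> S \<omega>))
      \<and> (m = 0 \<longrightarrow>
            pool_level lam p \<alpha> S m \<omega> 1
            = level_one_formula lam p \<alpha> S (pool_level lam p \<alpha> S m \<omega> 0) \<omega>)
      \<and> computed_mass lam p \<alpha> S m \<omega> = 1
      \<and> (\<forall>\<omega>'\<ge>0. computed_mass lam p \<alpha> S m \<omega>' = 1 \<longrightarrow> \<omega>' = \<omega>))"
proof -
  interpret mph1_queue lam p \<alpha> S
    using assms by unfold_locales auto
  let ?c = "(1 - lam) / (1 - p)"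
  have c: "0 < ?c" using assms by simp
  have idle_iff: "pool_idle lam p \<alpha> S m \<omega> = ?c \<longleftrightarrow> mass m \<omega> = 1 / ?c" if "0 \<le> \<omega>" for \<omega>
    unfolding pool_idle_eq[OF that] by (metis inverse_eq_divide inverse_inverse_eq)
  have mass_iff: "computed_mass lam p \<alpha> S m \<omega> = 1 \<longleftrightarrow> mass m \<omega> = 1 / ?c" for \<omega>
  proof -
    have "?c \<noteq> 0" using c by linarith
    then show ?thesis unfolding computed_mass_eq by (metis nonzero_eq_divide_eq mult.commute)
  qed
  have inj: "\<omega> = \<omega>'" if "0 \<le> \<omega>" "0 \<le> \<omega>'" "mass m \<omega> = mass m \<omega>'" for \<omega> \<omega>'
    using mass_strict_antimono[of \<omega> \<omega>' m] mass_strict_antimono[of \<omega>' \<omega> m] that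
    by (cases \<omega> \<omega>' rule: linorder_cases) auto

  have "\<exists>\<omega>\<ge>0. mass m \<omega> = 1 / ?c"
  proof -
    \<comment> \<open>Maximality of \<open>m\<close> enters at \<open>Suc m\<close>: the queue with
      that room is the chain at rate 0, so the mass starts at or above the target
      \<open>1 / ?c\<close>.\<close>
    have "\<not> ?c < mph1_idle lam p \<alpha> S (Suc m)" using assms(7)[of "Suc m"] by auto
    then have "1 / mass m 0 \<le> ?c" by (simp add: mph1_idle_Suc)
    then have "inverse ?c \<le> inverse (1 / mass m 0)"
      by (rule le_imp_inverse_le) (use mass_ge_1[of 0 m] in simp)
    then have upper: "1 / ?c \<le> mass m 0" by (simp only: inverse_eq_divide divide_divide_eq_right div_by_1 mult_1)
    obtain C where C: "0 \<le> C" "\<And>\<omega>. 0 < \<omega> \<Longrightarrow> mass m \<omega> \<le> 1 / mph1_idle lam p \<alpha> S m + C / \<omega>"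
      using mass_upper_bound[of m] by auto
    \<comment> \<open>The gap between the target mass and that of the queue with room for
      \<open>m\<close> jobs, positive by the strict inequality at \<open>m\<close>.\<close>
    define \<delta> where "\<delta> = 1 / ?c - 1 / mph1_idle lam p \<alpha> S m"
    have "0 < \<delta>" unfolding \<delta>_def using assms(6) c frac_less2[of 1 1 ?c "mph1_idle lam p \<alpha> S m"] by simp
    \<comment> \<open>Large enough for \<open>C / b \<le> \<delta>\<close>; the summand 1 keeps
      \<open>b\<close> positive when \<open>C = 0\<close>.\<close>
    define b where "b = C / \<delta> + 1"
    have "0 < b" using C(1) \<open>0 < \<delta>\<close> by (simp add: b_def add_nonneg_pos)
    have "C / b \<le> \<delta>" using \<open>0 < b\<close> \<open>0 < \<delta>\<close> by (simp add: b_def field_simps)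
    then have lower: "mass m b \<le> 1 / ?c" using C(2)[OF \<open>0 < b\<close>] by (simp add: \<delta>_def)
    have "continuous_on {0..b} (mass m)" by (rule continuous_on_subset[OF continuous_on_mass]) auto
    then show ?thesis using IVT2'[of "mass m" b "1 / ?c" 0] lower upper \<open>0 < b\<close> by auto
  qed
  then have ex: "\<exists>\<omega>\<ge>0. pool_idle lam p \<alpha> S m \<omega> = ?c" using idle_iff by blast

  have level: "pool_level lam p \<alpha> S m \<omega> q = ?c *\<^sub>R unnorm m \<omega> q"
    if "0 \<le> \<omega>" "pool_idle lam p \<alpha> S m \<omega> = ?c" "q \<le> m + 1" for \<omega> q
    using pool_level_eq[OF that(1,3)] that(2) by simp
  have low: "pool_level lam p \<alpha> S m \<omega> q = ?c *\<^sub>R (\<alpha> v* mat_power R q)"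
    if "0 \<le> \<omega>" "pool_idle lam p \<alpha> S m \<omega> = ?c" "q \<in> {1..m-1}" for \<omega> q
    using that level[OF that(1,2), of q] unnorm_below[of q m] by (auto simp: base_def)
  have top: "join_vec (pool_level lam p \<alpha> S m \<omega> m) (pool_level lam p \<alpha> S m \<omega> (m + 1))
      = join_vec (- lam *\<^sub>R pool_level lam p \<alpha> S m \<omega> (m - 1)) 0 v* matrix_inv (Top \<omega>)"
    if "0 \<le> \<omega>" "pool_idle lam p \<alpha> S m \<omega> = ?c" "1 \<le> m" for \<omega>
  proof -
    have "join_vec (pool_level lam p \<alpha> S m \<omega> m) (pool_level lam p \<alpha> S m \<omega> (m + 1))
      = ?c *\<^sub>R top_formula lam p \<alpha> S (base (m - 1)) \<omega>"
      unfolding unnorm_top[OF that(3), symmetric] join_vec_scaleR using level[OF that(1,2)] by simp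
    also have "\<dots> = top_formula lam p \<alpha> S (pool_level lam p \<alpha> S m \<omega> (m - 1)) \<omega>"
      using level[OF that(1,2), of "m - 1"] that(3) by (simp add: unnorm_below top_formula_scaleR)
    finally show ?thesis by (simp only: top_formula_def)
  qed
  have one: "pool_level lam p \<alpha> S m \<omega> 1 = level_one_formula lam p \<alpha> S (pool_level lam p \<alpha> S m \<omega> 0) \<omega>"
    if "0 \<le> \<omega>" "pool_idle lam p \<alpha> S m \<omega> = ?c" "m = 0" for \<omega>
    using level[OF that(1,2), of 0] level[OF that(1,2), of 1] that(3) unnorm_level_one[of \<omega>]
    by (simp add: level_one_formula_scaleR)

  show ?thesis
    using invertible_A transient_invertible[OF transient_Top] ex low top one
    by (intro conjI allI impI ballI) (auto simp: mass_iff idle_iff intro: inj)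
qed

end
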